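(* Let $(X,T)$ be a topological dynamical system. If $\dim(X,T)<\infty$, then there is an integer $n\geq 1$ for which $$\bigl\{f\in C(X,[0,1]^n): I_f\text{ is a topological embedding}\bigr\}$$ is a dense $G_\delta$ subset of $C(X,[0,1]^n)$.
   Context: A topological dynamical system $(X,T)$ consists of a nonempty compact metrizable space $X$ and a homeomorphism $T\colon X\to X$. The space $C(X,[0,1]^n)$ of continuous maps carries the uniform topology (norm $\|f-g\|_\infty=\sup_{x}\max_{1\le c\le n}|f_c(x)-g_c(x)|$). For $f\in C(X,[0,1]^n)$ the orbit map is $I_f\colon X\to([0,1]^n)^{\mathbb Z}$ (product topology on the target), $I_f(x)=(f(T^kx))_{k\in\mathbb Z}$. Dynamical dimension (Meyerovitch): let $\mathrm{Cov}(X)$ be the set of finite open covers of $X$, and $\mathrm{Prob}(X,T)$ the set of $T$-invariant Borel probability measures on $X$. For $\mathcal V\in\mathrm{Cov}(X)$ put $\mathrm{ord}(\mathcal V,x)=\#\{V\in\mathcal V:x\in V\}-1$ and $\mathrm{ord}(\mathcal V,T)=\sup_{\mu\in\mathrm{Prob}(X,T)}\int_X\mathrm{ord}(\mathcal V,x)\,d\mu(x)$. Write $\mathcal V\succeq\mathcal U$ if every $V\in\mathcal V$ is contained in some $U\in\mathcal U$. Then $$\dim(\mathcal U,T)=\inf_{\mathcal V\in\mathrm{Cov}(X),\ \mathcal V\succeq\mathcal U}\mathrm{ord}(\mathcal V,T),\qquad \dim(X,T)=\sup_{\mathcal U\in\mathrm{Cov}(X)}\dim(\mathcal U,T)\in[0,\infty].$$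 *)

theory Defs
  imports "HOL-Probability.Probability"
begin

definition finite_open_covers :: "'a::topological_space set set set" where
  "finite_open_covers = {\<U>. finite \<U> \<and> (\<forall>U\<in>\<U>. open U) \<and> \<Union>\<U> = UNIV}"

definition refines :: "'a set set \<Rightarrow> 'a set set \<Rightarrow> bool" (infix "refines" 50) where
  "\<V> refines \<U> \<longleftrightarrow> (\<forall>V\<in>\<V>. \<exists>U\<in>\<U>. V \<subseteq> U)"

definition invariant_measures :: "('a::topological_space \<Rightarrow> 'a) \<Rightarrow> 'a measure set" where
  "invariant_measures T =
     {\<mu>. prob_space \<mu> \<and> sets \<mu> = sets borel \<and> (\<forall>A\<in>sets borel. emeasure \<mu> (T -` A) = emeasure \<mu> A)}"

definition cover_ord :: "'a set set \<Rightarrow> 'a \<Rightarrow> real" where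
  "cover_ord \<V> x = real (card {V\<in>\<V>. x \<in> V}) - 1"

definition cover_ord_dyn :: "'a::topological_space set set \<Rightarrow> ('a \<Rightarrow> 'a) \<Rightarrow> ereal" where
  "cover_ord_dyn \<V> T = (SUP \<mu>\<in>invariant_measures T. ereal (\<integral>x. cover_ord \<V> x \<partial>\<mu>))"

definition cover_dyn_dim :: "'a::topological_space set set \<Rightarrow> ('a \<Rightarrow> 'a) \<Rightarrow> ereal" where
  "cover_dyn_dim \<U> T = (INF \<V>\<in>{\<V>\<in>finite_open_covers. \<V> refines \<U>}. cover_ord_dyn \<V> T)"

definition dyn_dim :: "('a::topological_space \<Rightarrow> 'a) \<Rightarrow> ereal" where
  "dyn_dim T = (SUP \<U>\<in>finite_open_covers. cover_dyn_dim \<U> T)"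

text \<open>
  The dimension \<open>n\<close> is a term and not a type because it is quantified existentially: points of \<open>[0,1]\<^sup>n\<close> are functions on
  \<open>{..<n}\<close>, extended by \<^const>\<open>undefined\<close>. The maximum metric is meaningful
  only for \<open>n \<ge> 1\<close>; with it the distance of \<^term>\<open>cfunspace\<close> is the supremum norm of the
  difference.
\<close>

definition cube :: "nat \<Rightarrow> (nat \<Rightarrow> real) metric" where
  "cube n = metric ({..<n} \<rightarrow>\<^sub>E {0..1}, \<lambda>u v. MAX c\<in>{..<n}. \<bar>u c - v c\<bar>)"

lemma Metric_space_cube:
  assumes "n \<ge> 1"
  shows "Metric_space ({..<n} \<rightarrow>\<^sub>E {0..1}) (\<lambda>u v :: nat \<Rightarrow> real. MAX c\<in>{..<n}. \<bar>u c - v c\<bar>)"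
proof
  have ne: "{..<n} \<noteq> {}" using assms by (auto simp: lessThan_empty_iff)
  fix u v w :: "nat \<Rightarrow> real"
  show "0 \<le> (MAX c\<in>{..<n}. \<bar>u c - v c\<bar>)"
    using ne by (subst Max_ge_iff) auto
  show "(MAX c\<in>{..<n}. \<bar>u c - v c\<bar>) = (MAX c\<in>{..<n}. \<bar>v c - u c\<bar>)"
    by (simp add: abs_minus_commute)
  assume u: "u \<in> {..<n} \<rightarrow>\<^sub>E {0..1}" and v: "v \<in> {..<n} \<rightarrow>\<^sub>E {0..1}"
  have le: "\<bar>u c - v c\<bar> \<le> (MAX c\<in>{..<n}. \<bar>u c - v c\<bar>)" if "c < n" for c and u v :: "nat \<Rightarrow> real"
    using that by (intro Max_ge) auto
  show "(MAX c\<in>{..<n}. \<bar>u c - v c\<bar>) = 0 \<longleftrightarrow> u = v"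
  proof
    assume 0: "(MAX c\<in>{..<n}. \<bar>u c - v c\<bar>) = 0"
    show "u = v"
    proof (rule PiE_ext[OF u v])
      fix c assume "c \<in> {..<n}"
      then show "u c = v c" using le[of c u v] 0 by simp
    qed
  next
    assume "u = v"
    then have "(\<lambda>c. \<bar>u c - v c\<bar>) ` {..<n} = {0}" using ne by auto
    then show "(MAX c\<in>{..<n}. \<bar>u c - v c\<bar>) = 0" by simp
  qed
  show "(MAX c\<in>{..<n}. \<bar>u c - w c\<bar>)
      \<le> (MAX c\<in>{..<n}. \<bar>u c - v c\<bar>) + (MAX c\<in>{..<n}. \<bar>v c - w c\<bar>)"
  proof (rule Max.boundedI)
    fix a assume "a \<in> (\<lambda>c. \<bar>u c - w c\<bar>) ` {..<n}"
    then obtain c where c: "c < n" "a = \<bar>u c - w c\<bar>" by auto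
    then show "a \<le> (MAX c\<in>{..<n}. \<bar>u c - v c\<bar>) + (MAX c\<in>{..<n}. \<bar>v c - w c\<bar>)"
      using le[of c u v] le[of c v w] by linarith
  qed (use ne in auto)
qed

lemma mspace_cube: "n \<ge> 1 \<Longrightarrow> mspace (cube n) = {..<n} \<rightarrow>\<^sub>E {0..1}"
  unfolding cube_def by (rule Metric_space.mspace_metric[OF Metric_space_cube])

lemma mdist_cube: "n \<ge> 1 \<Longrightarrow> mdist (cube n) u v = (MAX c\<in>{..<n}. \<bar>u c - v c\<bar>)"
  unfolding cube_def by (subst Metric_space.mdist_metric[OF Metric_space_cube]) auto

lemma mtopology_cube:
  assumes n: "n \<ge> 1"
  shows "mtopology_of (cube n) = product_topology (\<lambda>_. top_of_set {0..1}) {..<n}" (is "?M = ?P")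
proof -
  interpret Metric_space "mspace (cube n)" "mdist (cube n)" by simp
  have M: "?M = mtopology" by (simp add: mtopology_of_def)
  have ts: "topspace ?M = topspace ?P" by (simp add: mspace_cube[OF n])
  have ne: "{..<n} \<noteq> {}" using n by (auto simp: lessThan_empty_iff)
  have "continuous_map ?P ?M (\<lambda>x. x)"
    unfolding M continuous_map_to_metric
  proof (intro ballI allI impI)
    fix x and \<epsilon> :: real assume x: "x \<in> topspace ?P" and e: "0 < \<epsilon>"
    let ?U = "\<Pi>\<^sub>E c\<in>{..<n}. {0..1} \<inter> ball (x c) \<epsilon>"
    have "openin ?P ?U"
      by (subst openin_PiE_gen) (auto intro: openin_open_Int)
    moreover have "x \<in> ?U" using x e by (auto simp: PiE_iff)
    moreover have "y \<in> mball x \<epsilon>" if y: "y \<in> ?U" for y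
    proof -
      have "mdist (cube n) x y < \<epsilon>"
        using y ne by (auto simp: mdist_cube[OF n] PiE_iff dist_real_def)
      moreover have "y \<in> mspace (cube n)" using y by (auto simp: mspace_cube[OF n] PiE_iff)
      moreover have "x \<in> mspace (cube n)" using x ts by simp
      ultimately show ?thesis by (simp only: in_mball)
    qed
    ultimately show "\<exists>U. openin ?P U \<and> x \<in> U \<and> (\<forall>y\<in>U. y \<in> mball x \<epsilon>)" by blast
  qed
  moreover have "continuous_map ?M ?P (\<lambda>x. x)"
  proof (rule iffD2[OF continuous_map_componentwise], intro conjI ballI)
    show "(\<lambda>x. x) ` topspace ?M \<subseteq> extensional {..<n}"
      unfolding ts topspace_product_topology by (simp add: PiE_def)
    fix c assume c: "c \<in> {..<n}"
    have "continuous_map mtopology Met_TC.mtopology (\<lambda>x. x c)"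
      unfolding Met_TC.continuous_map_to_metric
    proof (intro ballI allI impI)
      fix x and \<epsilon> :: real assume x: "x \<in> topspace mtopology" and e: "0 < \<epsilon>"
      have "y c \<in> Met_TC.mball (x c) \<epsilon>" if "y \<in> mball x \<epsilon>" for y
      proof -
        have "(MAX c\<in>{..<n}. \<bar>x c - y c\<bar>) < \<epsilon>"
          using that by (simp add: mdist_cube[OF n])
        then have "\<bar>x c - y c\<bar> < \<epsilon>"
          using c ne by (subst (asm) Max_less_iff) auto
        then show ?thesis by (simp add: dist_real_def)
      qed
      then show "\<exists>U. openin mtopology U \<and> x \<in> U \<and> (\<forall>y\<in>U. y c \<in> Met_TC.mball (x c) \<epsilon>)"
        using x e by (intro exI[of _ "mball x \<epsilon>"]) simp
    qed
    then have "continuous_map mtopology euclideanreal (\<lambda>x. x c)"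
      by simp
    then show "continuous_map ?M (top_of_set {0..1}) (\<lambda>x. x c)"
      using c ts unfolding M continuous_map_in_subtopology
      by (simp only: topspace_product_topology) (auto simp: PiE_iff)
  qed
  ultimately show ?thesis
    using topology_finer_continuous_id[OF ts] topology_finer_continuous_id[OF ts[symmetric]]
    unfolding topology_eq id_def by blast
qed

abbreviation cube_maps :: "nat \<Rightarrow> ('a::topological_space \<Rightarrow> nat \<Rightarrow> real) metric" where
  "cube_maps n \<equiv> cfunspace euclidean (cube n)"

lemma mspace_cube_maps:
  assumes "compact (UNIV :: 'a::topological_space set)"
  shows "mspace (cube_maps n) = {f :: 'a \<Rightarrow> _. continuous_map euclidean (mtopology_of (cube n)) f}"
proof -
  interpret Metric_space "mspace (cube n)" "mdist (cube n)" by simp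
  have "mbounded (range f)" if "continuous_map euclidean mtopology f" for f :: "'a \<Rightarrow> _"
    using image_compactin[OF _ that, of UNIV] assms by (auto intro: compactin_imp_mbounded)
  then show ?thesis
    by (auto simp: mtopology_of_def continuous_map_def Pi_iff)
qed

lemma mdist_cube_maps:
  assumes "f \<in> mspace (cube_maps n)" "g \<in> mspace (cube_maps n)"
  shows "mdist (cube_maps n) f g = (SUP x. mdist (cube n) (f x) (g x))"
proof -
  interpret Metric_space "mspace (cube n)" "mdist (cube n)" by simp
  have "f \<in> fspace UNIV" "g \<in> fspace UNIV"
    using assms cfunspace_subset_funspace by (fastforce simp: mspace_funspace)+
  then show ?thesis
    unfolding mdist_cfunspace_eq_mdist_funspace mdist_funspace fdist_def by simp
qed

definition int_iterate :: "('a \<Rightarrow> 'a) \<Rightarrow> int \<Rightarrow> 'a \<Rightarrow> 'a" where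
  "int_iterate T k = (if k \<ge> 0 then T ^^ nat k else inv T ^^ nat (- k))"

definition orbit_map :: "('a \<Rightarrow> 'a) \<Rightarrow> ('a \<Rightarrow> 'b) \<Rightarrow> 'a \<Rightarrow> int \<Rightarrow> 'b" where
  "orbit_map T f x = (\<lambda>k. f (int_iterate T k x))"

definition embedding_cube_maps ::
    "('a::topological_space \<Rightarrow> 'a) \<Rightarrow> nat \<Rightarrow> ('a \<Rightarrow> nat \<Rightarrow> real) set" where
  "embedding_cube_maps T n =
     {f \<in> mspace (cube_maps n).
        embedding_map euclidean (product_topology (\<lambda>_. mtopology_of (cube n)) UNIV) (orbit_map T f)}"

end

theory Submission
  imports Defs
begin

text \<open>
  By Baire's theorem it suffices that, for each \<open>\<epsilon>\<close>, the maps whose orbit maps separate all pairs of points at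
  distance at least \<open>\<epsilon>\<close> are dense. Let \<open>D - 1\<close> exceed the dynamical dimension. A fine cover \<open>\<V>\<close> of small
  dynamical order has a partition of unity \<open>\<phi>\<close> subordinate to closed sets; since every limit of empirical measures is
  dominated on closed sets by an invariant measure, each orbit segment of some fixed length \<open>N\<close> meets
  the supports on average at most \<open>D\<close> times per step. Hence the word \<open>p k = \<phi> (T ^ k x)\<close> has at most \<open>D\<close> nonzero
  coordinates per unit of time.

  Approximate \<open>f\<close> by \<open>x \<mapsto> G (p 0, \<dots>, p (L - 1))\<close>, where \<open>G\<close> is a polynomial of high degree whose
  coefficients are algebraically independent reals. Its values at distinct points satisfy independent conditions, so by
  counting transcendence degrees \<open>G\<close> cannot take equal values along two words as soon as the number of distinct windows
  times the number of coordinates of \<open>G\<close> exceeds the number of nonzero parameters of the words. A word with few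
  distinct windows is periodic and therefore has correspondingly few parameters, so a number of
  coordinates proportional to \<open>D\<close> is enough.
\<close>

section \<open>Algebraically independent reals\<close>

text \<open>The equations attached to successive times are not independent as they stand: a window
  of a word can recur, or be a window of the other word at another time. So distinct windows are
  counted, and the equations are selected as an edge cover of the graph whose edges join the two
  windows seen at the same time; this costs a factor 2. If windows of length \<open>4 * B\<close>
  repeat early in both words, the words are periodic on the positions from \<open>B\<close> to
  \<open>4 * B\<close>, and one then needs windows short enough to stay inside that stretch. Hence
  two polynomial maps, \<open>G\<close> on windows of length \<open>4 * B\<close> and
  \<open>H\<close> on windows of length \<open>2 * B\<close>, with \<open>21 * D\<close> coordinates
  each, and \<open>n = 42 * D\<close>. The bound on nonzero coordinates holds only for blocks of
  length \<open>N\<close>, while a period may be shorter. With \<open>B = N * N\<close> there is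
  room for \<open>N\<close> copies of such a period in the periodic stretch, so the bound passes to
  a single period.\<close>

definition monom_val :: "nat \<Rightarrow> (nat \<Rightarrow> real) \<Rightarrow> (nat \<Rightarrow> nat) \<Rightarrow> real" where
  "monom_val m w \<alpha> = (\<Prod>i<m. w i ^ \<alpha> i)"

text \<open>Independence over the rationals: every polynomial has its exponents in some box
  \<open>{..<K}\<close>, and a box has the size \<open>K ^ m\<close> used in the later
  count.\<close>

definition alg_indep :: "nat \<Rightarrow> (nat \<Rightarrow> real) \<Rightarrow> bool" where
  "alg_indep m w \<longleftrightarrow> (\<forall>K (c :: (nat \<Rightarrow> nat) \<Rightarrow> rat).
     (\<Sum>\<alpha>\<in>{..<m} \<rightarrow>\<^sub>E {..<K}. of_rat (c \<alpha>) * monom_val m w \<alpha>) = 0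
     \<longrightarrow> (\<forall>\<alpha>\<in>{..<m} \<rightarrow>\<^sub>E {..<K}. c \<alpha> = 0))"

lemma sum_PiE_Suc:
  fixes h :: "(nat \<Rightarrow> nat) \<Rightarrow> 'b::comm_monoid_add"
  shows "(\<Sum>\<alpha>\<in>{..<Suc m} \<rightarrow>\<^sub>E {..<K}. h \<alpha>) = (\<Sum>j<K. \<Sum>\<alpha>\<in>{..<m} \<rightarrow>\<^sub>E {..<K}. h (\<alpha>(m := j)))"
proof -
  have "({..<Suc m} \<rightarrow>\<^sub>E {..<K}) = (\<lambda>(y, g). g(m := y)) ` ({..<K} \<times> ({..<m} \<rightarrow>\<^sub>E {..<K}))"
    unfolding lessThan_Suc PiE_insert_eq ..
  moreover have "inj_on (\<lambda>(y, g). g(m := y)) ({..<K} \<times> ({..<m} \<rightarrow>\<^sub>E {..<K}))"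
    using inj_combinator[of m "{..<m}" "\<lambda>_. {..<K}"] by simp
  ultimately have "(\<Sum>\<alpha>\<in>{..<Suc m} \<rightarrow>\<^sub>E {..<K}. h \<alpha>)
     = (\<Sum>z\<in>{..<K} \<times> ({..<m} \<rightarrow>\<^sub>E {..<K}). h (case z of (y, g) \<Rightarrow> g(m := y)))"
    by (simp add: sum.reindex)
  also have "\<dots> = (\<Sum>j<K. \<Sum>\<alpha>\<in>{..<m} \<rightarrow>\<^sub>E {..<K}. h (\<alpha>(m := j)))"
    by (simp add: sum.cartesian_product split_def)
  finally show ?thesis .
qed

lemma monom_val_Suc_upd:
  "monom_val (Suc m) (w(m := t)) (\<alpha>(m := j)) = monom_val m w \<alpha> * t ^ j"
  by (simp add: monom_val_def)

text \<open>The polynomials over the countable ring of rational polynomials in \<open>w\<close> are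
  countable in number, and each nonzero one has finitely many roots, so the roots cannot exhaust an
  interval. A relation for the extended family is such a polynomial with root \<open>t\<close>; its
  coefficients vanish, and the independence of \<open>w\<close> applies to each.\<close>

lemma alg_indep_Suc_ex:
  assumes w: "alg_indep m w" and ab: "a < (b::real)"
  shows "\<exists>t. a < t \<and> t < b \<and> alg_indep (Suc m) (w(m := t))"
proof -
  define Q :: "nat \<Rightarrow> real set" where
    "Q K = (\<lambda>c. \<Sum>\<alpha>\<in>{..<m} \<rightarrow>\<^sub>E {..<K}. of_rat (c \<alpha>) * monom_val m w \<alpha>)
            ` (({..<m} \<rightarrow>\<^sub>E {..<K}) \<rightarrow>\<^sub>E (UNIV :: rat set))" for K
  have "countable (Q K)" for K
    unfolding Q_def by (intro countable_image countable_PiE) (auto intro: finite_PiE)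
  then have "countable (\<Union>K. Q K)" by blast
  then have "countable (Poly ` lists (\<Union>K. Q K))" by (intro countable_image countable_lists)
  then have "countable (\<Union>p\<in>Poly ` lists (\<Union>K. Q K) - {0}. {t. poly p t = 0})"
    by (intro countable_UN) (auto intro: countable_finite poly_roots_finite)
  moreover have "uncountable {a<..<b}" using ab by (simp add: uncountable_open_interval)
  ultimately obtain t where t: "t \<in> {a<..<b}"
    and nt: "t \<notin> (\<Union>p\<in>Poly ` lists (\<Union>K. Q K) - {0}. {t. poly p t = 0})"
    by (meson countable_subset subsetI)
  have "alg_indep (Suc m) (w(m := t))"
    unfolding alg_indep_def
  proof (intro allI impI ballI)
    fix K and c :: "(nat \<Rightarrow> nat) \<Rightarrow> rat" and \<alpha>
    assume eq: "(\<Sum>\<alpha>\<in>{..<Suc m} \<rightarrow>\<^sub>E {..<K}. of_rat (c \<alpha>) * monom_val (Suc m) (w(m := t)) \<alpha>) = 0"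
      and \<alpha>: "\<alpha> \<in> {..<Suc m} \<rightarrow>\<^sub>E {..<K}"
    define r where "r j = (\<Sum>\<alpha>\<in>{..<m} \<rightarrow>\<^sub>E {..<K}. of_rat (c (\<alpha>(m := j))) * monom_val m w \<alpha>)" for j
    define p where "p = Poly (map r [0..<K])"
    have rQ: "r j \<in> Q K" for j
      unfolding r_def Q_def
      by (intro image_eqI[where x = "restrict (\<lambda>\<alpha>. c (\<alpha>(m := j))) ({..<m} \<rightarrow>\<^sub>E {..<K})"]) auto
    have cf: "coeff p j = (if j < K then r j else 0)" for j
      by (simp add: p_def coeff_Poly_eq nth_default_def)
    have "degree p \<le> K" by (rule degree_le) (simp add: cf)
    then have "poly p t = (\<Sum>j<Suc K. coeff p j * t ^ j)"
      unfolding poly_altdef by (intro sum.mono_neutral_left) (auto simp: coeff_eq_0)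
    also have "\<dots> = (\<Sum>j<K. r j * t ^ j)" by (simp add: cf)
    also have "\<dots> = 0"
      using eq unfolding sum_PiE_Suc monom_val_Suc_upd r_def sum_distrib_right
      by (simp add: mult_ac)
    finally have "poly p t = 0" .
    moreover have "p \<in> Poly ` lists (\<Union>K. Q K)"
      unfolding p_def by (intro imageI in_listsI ballI UN_I[of K]) (auto simp: rQ)
    ultimately have "p = 0" using nt by blast
    then have r0: "r j = 0" if "j < K" for j using cf[of j] that by simp
    \<comment> \<open>Extensional functions on \<open>{..<m}\<close> are \<open>undefined\<close> at
      \<open>m\<close>; the update removes the last exponent.\<close>
    define \<beta> where "\<beta> = \<alpha>(m := undefined)"
    have \<beta>: "\<beta> \<in> {..<m} \<rightarrow>\<^sub>E {..<K}" and j: "\<alpha> m < K" and ab: "\<alpha> = \<beta>(m := \<alpha> m)"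
      using \<alpha> by (auto simp: \<beta>_def PiE_iff extensional_def)
    have "c (\<beta>(m := \<alpha> m)) = 0"
      using w[unfolded alg_indep_def, rule_format, where c = "\<lambda>\<gamma>. c (\<gamma>(m := \<alpha> m))", OF _ \<beta>]
        r0[OF j] unfolding r_def by blast
    then show "c \<alpha> = 0" using ab by simp
  qed
  then show ?thesis using t by auto
qed

text \<open>The coordinates are picked one after the other from intervals around the
  \<open>a i\<close>. The closeness lets generic coefficients perturb a prescribed
  polynomial.\<close>

lemma alg_indep_near_ex:
  assumes "\<eta> > 0"
  shows "\<exists>w. (\<forall>i<m. \<bar>w i - a i\<bar> < (\<eta>::real)) \<and> alg_indep m w"
proof (induction m)
  case 0
  show ?case by (auto simp: alg_indep_def monom_val_def)
next
  case (Suc m)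
  then obtain w where w: "\<And>i. i < m \<Longrightarrow> \<bar>w i - a i\<bar> < \<eta>" "alg_indep m w" by blast
  obtain t where "a m - \<eta> < t" "t < a m + \<eta>" "alg_indep (Suc m) (w(m := t))"
    using alg_indep_Suc_ex[OF w(2), of "a m - \<eta>" "a m + \<eta>"] assms by auto
  moreover from this have "\<forall>i<Suc m. \<bar>(w(m := t)) i - a i\<bar> < \<eta>"
    using w(1) by (auto simp: less_Suc_eq abs_less_iff)
  ultimately show ?case by blast
qed

section \<open>Generated subfields of the reals and transcendence degree\<close>

inductive_set gen_field :: "real set \<Rightarrow> real set" for S where
  base: "x \<in> S \<Longrightarrow> x \<in> gen_field S"
| one: "1 \<in> gen_field S"
| diff: "x \<in> gen_field S \<Longrightarrow> y \<in> gen_field S \<Longrightarrow> x - y \<in> gen_field S"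
| mult: "x \<in> gen_field S \<Longrightarrow> y \<in> gen_field S \<Longrightarrow> x * y \<in> gen_field S"
| inverse: "x \<in> gen_field S \<Longrightarrow> inverse x \<in> gen_field S"

lemma gen_field_zero: "0 \<in> gen_field S"
  using gen_field.diff[OF gen_field.one gen_field.one] by simp

lemma gen_field_uminus: "x \<in> gen_field S \<Longrightarrow> - x \<in> gen_field S"
  using gen_field.diff[OF gen_field_zero] by fastforce

lemma gen_field_add: "x \<in> gen_field S \<Longrightarrow> y \<in> gen_field S \<Longrightarrow> x + y \<in> gen_field S"
  using gen_field.diff[OF _ gen_field_uminus] by fastforce

lemma gen_field_divide: "x \<in> gen_field S \<Longrightarrow> y \<in> gen_field S \<Longrightarrow> x / y \<in> gen_field S"
  by (simp add: divide_inverse gen_field.mult gen_field.inverse)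

lemma gen_field_sum: "(\<And>i. i \<in> I \<Longrightarrow> f i \<in> gen_field S) \<Longrightarrow> sum f I \<in> gen_field S"
  by (induction I rule: infinite_finite_induct) (auto intro: gen_field_zero gen_field_add)

lemma gen_field_prod: "(\<And>i. i \<in> I \<Longrightarrow> f i \<in> gen_field S) \<Longrightarrow> prod f I \<in> gen_field S"
  by (induction I rule: infinite_finite_induct) (auto intro: gen_field.one gen_field.mult)

lemma gen_field_mono: "x \<in> gen_field S \<Longrightarrow> S \<subseteq> S' \<Longrightarrow> x \<in> gen_field S'"
  by (induction rule: gen_field.induct) (auto intro: gen_field.intros)

text \<open>The reals as a vector space over the rationals, which makes dimension bounds for spans
  available.\<close>

definition rat_scale :: "rat \<Rightarrow> real \<Rightarrow> real" where "rat_scale q x = of_rat q * x"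

interpretation rat_real: vector_space rat_scale
  by unfold_locales (auto simp: rat_scale_def algebra_simps of_rat_add of_rat_mult)

text \<open>Values at \<open>u\<close> of rational polynomials of degree at most \<open>A\<close> in
  each variable. Bounding the variables separately gives a box of \<open>(A + 1) ^ d\<close>
  exponents.\<close>

definition poly_span :: "nat \<Rightarrow> (nat \<Rightarrow> real) \<Rightarrow> nat \<Rightarrow> real set" where
  "poly_span d u A = rat_real.span (monom_val d u ` ({..<d} \<rightarrow>\<^sub>E {..A}))"

lemma poly_span_mono: "x \<in> poly_span d u A \<Longrightarrow> A \<le> A' \<Longrightarrow> x \<in> poly_span d u A'"
  unfolding poly_span_def
  by (rule subsetD[OF rat_real.span_mono]) (auto intro!: image_mono PiE_mono)

lemma poly_span_mult:
  assumes x: "x \<in> poly_span d u A" and y: "y \<in> poly_span d u A'"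
  shows "x * y \<in> poly_span d u (A + A')"
proof -
  have m: "monom_val d u \<alpha> * monom_val d u \<beta> \<in> poly_span d u (A + A')"
    if a: "\<alpha> \<in> {..<d} \<rightarrow>\<^sub>E {..A}" and b: "\<beta> \<in> {..<d} \<rightarrow>\<^sub>E {..A'}" for \<alpha> \<beta>
  proof -
    have "monom_val d u \<alpha> * monom_val d u \<beta> = monom_val d u (restrict (\<lambda>i. \<alpha> i + \<beta> i) {..<d})"
      by (simp add: monom_val_def power_add prod.distrib)
    then show ?thesis
      unfolding poly_span_def using a b
      by (intro rat_real.span_base image_eqI) (auto simp: PiE_iff add_mono)
  qed
  have sub: "rat_real.subspace {y. c * y \<in> rat_real.span B}" for c B
  proof (rule rat_real.subspaceI)
    show "0 \<in> {y. c * y \<in> rat_real.span B}" by (simp add: rat_real.span_zero)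
    fix y z :: real and q
    assume y: "y \<in> {y. c * y \<in> rat_real.span B}"
    show "rat_scale q y \<in> {y. c * y \<in> rat_real.span B}"
      using rat_real.span_scale[of "c * y" B q] y by (simp add: rat_scale_def mult.left_commute)
    assume z: "z \<in> {y. c * y \<in> rat_real.span B}"
    show "y + z \<in> {y. c * y \<in> rat_real.span B}"
      using rat_real.span_add[of "c * y" B "c * z"] y z by (simp add: distrib_left)
  qed
  have 1: "monom_val d u \<alpha> * y \<in> poly_span d u (A + A')" if a: "\<alpha> \<in> {..<d} \<rightarrow>\<^sub>E {..A}" for \<alpha>
    using rat_real.span_induct[OF y[unfolded poly_span_def] sub] m[OF a] unfolding poly_span_def by blast
  have "y * x \<in> rat_real.span (monom_val d u ` ({..<d} \<rightarrow>\<^sub>E {..A + A'}))"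
  proof (rule rat_real.span_induct[OF x[unfolded poly_span_def] sub])
    fix z assume "z \<in> monom_val d u ` ({..<d} \<rightarrow>\<^sub>E {..A})"
    then show "y * z \<in> rat_real.span (monom_val d u ` ({..<d} \<rightarrow>\<^sub>E {..A + A'}))"
      using 1 unfolding poly_span_def by (auto simp: mult.commute)
  qed
  then have "y * x \<in> poly_span d u (A + A')" by (simp add: poly_span_def)
  then show ?thesis by (simp add: mult.commute)
qed

lemma poly_span_one: "1 \<in> poly_span d u A"
proof -
  have "monom_val d u (restrict (\<lambda>_. 0) {..<d}) = 1" by (simp add: monom_val_def)
  then show ?thesis unfolding poly_span_def
    by (metis (no_types, lifting) PiE_restrict atMost_iff image_eqI rat_real.span_base restrict_PiE_iff zero_le)
qed

lemma poly_span_var: "i < d \<Longrightarrow> u i \<in> poly_span d u 1"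
proof -
  assume i: "i < d"
  have "monom_val d u (restrict (\<lambda>j. if j = i then 1 else 0) {..<d}) = (\<Prod>j<d. if j = i then u j else 1)"
    unfolding monom_val_def by (rule prod.cong) auto
  also have "\<dots> = u i" using i by (simp add: prod.delta)
  finally show ?thesis unfolding poly_span_def
    by (intro rat_real.span_base image_eqI[where x = "restrict (\<lambda>j. if j = i then 1 else 0) {..<d}"]) auto
qed

lemma poly_span_diff: "x \<in> poly_span d u A \<Longrightarrow> y \<in> poly_span d u A \<Longrightarrow> x - y \<in> poly_span d u A"
  unfolding poly_span_def by (rule rat_real.span_diff)

lemma poly_span_power: "x \<in> poly_span d u A \<Longrightarrow> x ^ k \<in> poly_span d u (A * k)"
proof (induction k)
  case (Suc k)
  then show ?case using poly_span_mult[OF Suc.prems Suc.IH[OF Suc.prems]] by simp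
qed (simp add: poly_span_one)

lemma poly_span_prod:
  "(\<And>i. i < m \<Longrightarrow> f i \<in> poly_span d u A) \<Longrightarrow> (\<Prod>i<m. f i) \<in> poly_span d u (m * A)"
  by (induction m) (auto simp: poly_span_one add.commute[of A] intro: poly_span_mult)

text \<open>Quotients of polynomial values contain the generators and are closed under the field
  operations. In the case of inverses, \<open>inverse 0 = 0\<close> is the fraction
  \<open>0 / 1\<close>.\<close>

lemma gen_field_imp_fraction:
  assumes "x \<in> gen_field (u ` {..<d})"
  shows "\<exists>A. \<exists>a\<in>poly_span d u A. \<exists>b\<in>poly_span d u A. b \<noteq> 0 \<and> x = a / b"
  using assms
proof (induction rule: gen_field.induct)
  case (base x)
  then obtain i where "i < d" "x = u i" by auto
  then show ?case using poly_span_var[of i d u] poly_span_one[of d u 1]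
    by (intro exI[of _ 1] bexI[of _ "u i"] bexI[of _ 1]) auto
next
  case one
  show ?case using poly_span_one[of d u 0] by (intro exI[of _ 0] bexI[of _ 1]) auto
next
  case (diff x y)
  then obtain A a b A' a' b' where
    *: "a \<in> poly_span d u A" "b \<in> poly_span d u A" "b \<noteq> 0" "x = a / b"
    "a' \<in> poly_span d u A'" "b' \<in> poly_span d u A'" "b' \<noteq> 0" "y = a' / b'" by blast
  have "a * b' - b * a' \<in> poly_span d u (A + A')" "b * b' \<in> poly_span d u (A + A')"
    using * by (auto intro: poly_span_diff poly_span_mult)
  moreover have "x - y = (a * b' - b * a') / (b * b')" using * by (simp add: field_simps)
  ultimately show ?case using * by (metis mult_eq_0_iff)
next
  case (mult x y)
  then obtain A a b A' a' b' where
    *: "a \<in> poly_span d u A" "b \<in> poly_span d u A" "b \<noteq> 0" "x = a / b"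
    "a' \<in> poly_span d u A'" "b' \<in> poly_span d u A'" "b' \<noteq> 0" "y = a' / b'" by blast
  have "a * a' \<in> poly_span d u (A + A')" "b * b' \<in> poly_span d u (A + A')"
    using * by (auto intro: poly_span_mult)
  moreover have "x * y = (a * a') / (b * b')" using * by simp
  ultimately show ?case using * by (metis mult_eq_0_iff)
next
  case (inverse x)
  then obtain A a b where *: "a \<in> poly_span d u A" "b \<in> poly_span d u A" "b \<noteq> 0" "x = a / b" by blast
  show ?case
  proof (cases "a = 0")
    case True
    have "0 \<in> poly_span d u 0" unfolding poly_span_def by (rule rat_real.span_zero)
    then show ?thesis using True * poly_span_one[of d u 0]
      by (intro exI[of _ 0] bexI[of _ 0] bexI[of _ 1]) auto
  next
    case False
    then have "inverse x = b / a" using * by simp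
    then show ?thesis using * False by blast
  qed
qed

text \<open>An injective family has too large an image to be independent in the span of
  \<open>B\<close>; a repeated value is itself a relation, with coefficients 1 and -1.\<close>

lemma rat_dependence:
  assumes fin: "finite A" "finite B" and card: "card B < card A"
    and x: "\<And>a. a \<in> A \<Longrightarrow> x a \<in> rat_real.span B"
  shows "\<exists>c. (\<exists>a\<in>A. c a \<noteq> 0) \<and> (\<Sum>a\<in>A. of_rat (c a) * x a) = 0"
proof (cases "inj_on x A")
  case True
  have "rat_real.dependent (x ` A)"
  proof (rule ccontr)
    assume "\<not> rat_real.dependent (x ` A)"
    then have "card (x ` A) \<le> card B"
      using rat_real.independent_span_bound[OF fin(2), of "x ` A"] x by blast
    then show False using card card_image[OF True] by simp
  qed
  then obtain u v where v: "v \<in> x ` A" "u v \<noteq> 0" and s: "(\<Sum>v\<in>x ` A. rat_scale (u v) v) = 0"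
    unfolding rat_real.dependent_finite[OF finite_imageI[OF fin(1)]] by blast
  show ?thesis
    using v s by (intro exI[of _ "u \<circ> x"]) (auto simp: sum.reindex[OF True] rat_scale_def)
next
  case False
  then obtain a b where ab: "a \<in> A" "b \<in> A" "a \<noteq> b" "x a = x b" by (auto simp: inj_on_def)
  define c :: "_ \<Rightarrow> rat" where "c i = (if i = a then 1 else if i = b then - 1 else 0)" for i
  have "(\<Sum>i\<in>A. of_rat (c i) * x i) = (\<Sum>i\<in>{a, b}. of_rat (c i) * x i)"
    using ab fin by (intro sum.mono_neutral_right) (auto simp: c_def)
  also have "\<dots> = 0" using ab by (simp add: c_def)
  finally show ?thesis using ab by (intro exI[of _ c]) (auto simp: c_def)
qed

text \<open>
  Count monomials of bounded degree: there are \<open>K ^ m\<close> in \<open>w\<close>, but after clearing denominators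
  only \<open>O(K ^ d)\<close> in the \<open>d\<close> generators.
\<close>

lemma alg_indep_le_generators:
  assumes w: "alg_indep m w" and fin: "finite S" and gen: "\<And>i. i < m \<Longrightarrow> w i \<in> gen_field S"
  shows "m \<le> card S"
proof (rule ccontr)
  assume "\<not> m \<le> card S"
  define d where "d = card S"
  obtain u where u: "S = u ` {..<d}"
    using ex_bij_betw_nat_finite[OF fin] by (auto simp: bij_betw_def d_def atLeast0LessThan)
  have dm: "d < m" using \<open>\<not> m \<le> card S\<close> by (simp add: d_def)
  have "\<forall>i\<in>{..<m}. \<exists>A. \<exists>a\<in>poly_span d u A. \<exists>b\<in>poly_span d u A. b \<noteq> 0 \<and> w i = a / b"
    using gen gen_field_imp_fraction u by blast
  then obtain A a b where *: "\<And>i. i < m \<Longrightarrow> a i \<in> poly_span d u (A i)"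
    "\<And>i. i < m \<Longrightarrow> b i \<in> poly_span d u (A i)" "\<And>i. i < m \<Longrightarrow> b i \<noteq> 0" "\<And>i. i < m \<Longrightarrow> w i = a i / b i"
    by (metis lessThan_iff)
  define A0 where "A0 = (\<Sum>i<m. A i)"
  have AA: "A i \<le> A0" if "i < m" for i unfolding A0_def using that by (intro member_le_sum) auto
  define C where "C = m * (A0 + A0)"
  \<comment> \<open>Chosen so that \<open>(C * K + 1) ^ d \<le> (C + 1) ^ d * K ^ d < K ^ Suc d
    \<le> K ^ m\<close>: there are fewer monomials in the generators than in
    \<open>w\<close>.\<close>
  define K where "K = Suc ((C + 1) ^ d)"
  \<comment> \<open>The first factor is the product of all \<open>b i ^ K\<close>, a common
    denominator for the monomials with exponents below \<open>K\<close>.\<close>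
  have mem: "monom_val m (\<lambda>i. b i ^ K * 1) (\<lambda>_. 1) * monom_val m w \<alpha> \<in> poly_span d u (C * K)"
    if \<alpha>: "\<alpha> \<in> {..<m} \<rightarrow>\<^sub>E {..<K}" for \<alpha>
  proof -
    have "monom_val m (\<lambda>i. b i ^ K * 1) (\<lambda>_. 1) * monom_val m w \<alpha> = (\<Prod>i<m. a i ^ \<alpha> i * b i ^ (K - \<alpha> i))"
      unfolding monom_val_def prod.distrib[symmetric]
    proof (rule prod.cong)
      fix i assume i: "i \<in> {..<m}"
      then have "\<alpha> i \<le> K" using \<alpha> by (force simp: PiE_iff)
      then have "b i ^ K = b i ^ \<alpha> i * b i ^ (K - \<alpha> i)" by (simp flip: power_add)
      then show "(b i ^ K * 1) ^ 1 * w i ^ \<alpha> i = a i ^ \<alpha> i * b i ^ (K - \<alpha> i)"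
        using * i by (simp add: power_divide)
    qed simp
    also have "\<dots> \<in> poly_span d u (m * ((A0 + A0) * K))"
    proof (rule poly_span_prod)
      fix i assume i: "i < m"
      then have "\<alpha> i < K" using \<alpha> by (force simp: PiE_iff)
      have "a i ^ \<alpha> i * b i ^ (K - \<alpha> i) \<in> poly_span d u (A i * \<alpha> i + A i * (K - \<alpha> i))"
        using * i by (intro poly_span_mult poly_span_power) auto
      then show "a i ^ \<alpha> i * b i ^ (K - \<alpha> i) \<in> poly_span d u ((A0 + A0) * K)"
      proof (rule poly_span_mono)
        have "A i * \<alpha> i + A i * (K - \<alpha> i) = A i * K"
          using \<open>\<alpha> i < K\<close> by (simp flip: distrib_left)
        also have "\<dots> \<le> (A0 + A0) * K" using AA[OF i] by (intro mult_right_mono) auto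
        finally show "A i * \<alpha> i + A i * (K - \<alpha> i) \<le> (A0 + A0) * K" .
      qed
    qed
    finally show ?thesis by (simp add: C_def mult.assoc)
  qed
  define \<beta> where "\<beta> = monom_val m (\<lambda>i. b i ^ K * 1) (\<lambda>_. 1)"
  have \<beta>0: "\<beta> \<noteq> 0" unfolding \<beta>_def monom_val_def using * by simp
  have "card (monom_val d u ` ({..<d} \<rightarrow>\<^sub>E {..C * K})) \<le> card ({..<d} \<rightarrow>\<^sub>E {..C * K})"
    by (intro card_image_le finite_PiE) auto
  also have "\<dots> = (C * K + 1) ^ d" by (simp add: card_PiE)
  also have "\<dots> \<le> ((C + 1) * K) ^ d" by (intro power_mono) (auto simp: K_def)
  also have "\<dots> = (C + 1) ^ d * K ^ d" by (rule power_mult_distrib)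
  also have "\<dots> < K * K ^ d" by (intro mult_strict_right_mono) (auto simp: K_def)
  also have "\<dots> = K ^ Suc d" by simp
  also have "\<dots> \<le> K ^ m" using dm by (intro power_increasing) (auto simp: K_def)
  also have "\<dots> = card ({..<m} \<rightarrow>\<^sub>E {..<K})" by (simp add: card_PiE)
  finally have "\<exists>c. (\<exists>\<alpha>\<in>{..<m} \<rightarrow>\<^sub>E {..<K}. c \<alpha> \<noteq> 0)
      \<and> (\<Sum>\<alpha>\<in>{..<m} \<rightarrow>\<^sub>E {..<K}. of_rat (c \<alpha>) * (\<beta> * monom_val m w \<alpha>)) = 0"
    using mem by (intro rat_dependence) (auto intro: finite_PiE simp: \<beta>_def poly_span_def)
  then obtain c where c: "\<exists>\<alpha>\<in>{..<m} \<rightarrow>\<^sub>E {..<K}. c \<alpha> \<noteq> 0"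
    and "(\<Sum>\<alpha>\<in>{..<m} \<rightarrow>\<^sub>E {..<K}. of_rat (c \<alpha>) * (\<beta> * monom_val m w \<alpha>)) = 0" by blast
  then have "\<beta> * (\<Sum>\<alpha>\<in>{..<m} \<rightarrow>\<^sub>E {..<K}. of_rat (c \<alpha>) * monom_val m w \<alpha>) = 0"
    by (simp add: sum_distrib_left mult_ac)
  then have "(\<Sum>\<alpha>\<in>{..<m} \<rightarrow>\<^sub>E {..<K}. of_rat (c \<alpha>) * monom_val m w \<alpha>) = 0" using \<beta>0 by simp
  then show False using w c unfolding alg_indep_def by blast
qed

section \<open>Generic polynomial maps\<close>

text \<open>The equations given by the forms are solved for the pivot unknowns \<open>E0\<close>.
  The pivots and the matrix \<open>M\<close> do not depend on the solution \<open>w\<close>, so they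
  serve all coordinates of a vector-valued unknown at once.\<close>

definition solves_forms ::
    "real set \<Rightarrow> 'e set \<Rightarrow> (nat \<Rightarrow> 'e \<Rightarrow> real) \<Rightarrow> nat \<Rightarrow> 'e set \<Rightarrow> ('e \<Rightarrow> 'e \<Rightarrow> real) \<Rightarrow> bool" where
  "solves_forms S E f r E0 M \<longleftrightarrow> E0 \<subseteq> E \<and> card E0 = r \<and> (\<forall>e\<in>E0. \<forall>e'\<in>E - E0. M e e' \<in> gen_field S)
     \<and> (\<forall>w. (\<forall>i<r. (\<Sum>e\<in>E. f i e * w e) = 0) \<longrightarrow> (\<forall>e\<in>E0. w e = (\<Sum>e'\<in>E - E0. M e e' * w e')))"

text \<open>Gaussian elimination, which never leaves the field of the coefficients. The dual vectors
  \<open>v j\<close> certify independence and may lie outside that field.\<close>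

lemma eliminate_forms:
  fixes f :: "nat \<Rightarrow> 'e \<Rightarrow> real"
  assumes fin: "finite E" and coef: "\<And>i e. i < r \<Longrightarrow> e \<in> E \<Longrightarrow> f i e \<in> gen_field S"
    and dual: "\<And>i j. i < r \<Longrightarrow> j < r \<Longrightarrow> (\<Sum>e\<in>E. f i e * v j e) = (if i = j then 1 else 0)"
  shows "\<exists>E0 M. solves_forms S E f r E0 M"
  using coef dual
proof (induction r)
  case 0
  show ?case by (intro exI[of _ "{}"]) (auto simp: solves_forms_def)
next
  case (Suc r)
  obtain E0 M where "solves_forms S E f r E0 M"
    using Suc.IH Suc.prems by (metis less_SucI)
  then have E0: "E0 \<subseteq> E" "card E0 = r"
    and M: "\<forall>e\<in>E0. \<forall>e'\<in>E - E0. M e e' \<in> gen_field S"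
    and sol': "\<forall>w. (\<forall>i<r. (\<Sum>e\<in>E. f i e * w e) = 0) \<longrightarrow> (\<forall>e\<in>E0. w e = (\<Sum>e'\<in>E - E0. M e e' * w e'))"
    unfolding solves_forms_def by blast+
  have sol: "w e = (\<Sum>e'\<in>E - E0. M e e' * w e')" if "\<forall>i<r. (\<Sum>e\<in>E. f i e * w e) = 0" "e \<in> E0" for w e
    using sol' that by blast
  define c where "c e' = f r e' + (\<Sum>e\<in>E0. f r e * M e e')" for e'
  have fE0: "finite E0" "finite (E - E0)" using E0 fin by (auto intro: finite_subset)
  have cF: "c e' \<in> gen_field S" if "e' \<in> E - E0" for e'
    unfolding c_def using that E0 M Suc.prems(1)[of r]
    by (intro gen_field_add gen_field_sum gen_field.mult) auto
  have red: "(\<Sum>e\<in>E. f r e * w e) = (\<Sum>e'\<in>E - E0. c e' * w e')"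
    if "\<forall>i<r. (\<Sum>e\<in>E. f i e * w e) = 0" for w
  proof -
    have "(\<Sum>e\<in>E. f r e * w e) = (\<Sum>e\<in>E - E0. f r e * w e) + (\<Sum>e\<in>E0. f r e * w e)"
      using sum.subset_diff[OF E0(1) fin] .
    also have "(\<Sum>e\<in>E0. f r e * w e) = (\<Sum>e\<in>E0. \<Sum>e'\<in>E - E0. f r e * M e e' * w e')"
      using sol[OF that] by (intro sum.cong) (auto simp: sum_distrib_left mult.assoc)
    also have "\<dots> = (\<Sum>e'\<in>E - E0. (\<Sum>e\<in>E0. f r e * M e e') * w e')"
      by (subst sum.swap) (simp add: sum_distrib_right)
    finally show ?thesis by (simp add: c_def distrib_right sum.distrib)
  qed
  \<comment> \<open>The earlier forms vanish at \<open>v r\<close>, so the reduced form has the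
    value 1 there; a nonzero coefficient is the next pivot.\<close>
  have "(\<Sum>e'\<in>E - E0. c e' * v r e') = 1"
    using red[of "v r"] Suc.prems(2) by auto
  then obtain e0 where e0: "e0 \<in> E - E0" "c e0 \<noteq> 0"
    by (metis (no_types, lifting) mult_zero_left sum.neutral zero_neq_one)
  define E1 where "E1 = insert e0 E0"
  define L where "L e' = - c e' / c e0" for e'
  define M1 where "M1 e e' = (if e = e0 then L e' else M e e' + M e e0 * L e')" for e e'
  have LF: "L e' \<in> gen_field S" if "e' \<in> E - E0" for e'
    unfolding L_def using cF[OF that] cF[OF e0(1)] by (intro gen_field_divide gen_field_uminus)
  have EE: "E - E0 = insert e0 (E - E1)" "e0 \<notin> E - E1" using e0 by (auto simp: E1_def)
  have fE1: "finite (E - E1)" using fin by simp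
  show ?case
    unfolding solves_forms_def
  proof (intro exI[of _ E1] exI[of _ M1] conjI ballI allI impI)
    show "E1 \<subseteq> E" "card E1 = Suc r" using E0 e0 fE0 by (auto simp: E1_def)
    show "M1 e e' \<in> gen_field S" if "e \<in> E1" "e' \<in> E - E1" for e e'
      using that e0 M LF EE by (auto simp: M1_def E1_def intro!: gen_field_add gen_field.mult)
    fix w e assume w: "\<forall>i<Suc r. (\<Sum>e\<in>E. f i e * w e) = 0" and e: "e \<in> E1"
    then have w': "\<forall>i<r. (\<Sum>e\<in>E. f i e * w e) = 0" by simp
    have "c e0 * w e0 + (\<Sum>e'\<in>E - E1. c e' * w e') = 0"
      using red[OF w'] w EE fE1 by simp
    then have "w e0 = - (\<Sum>e'\<in>E - E1. c e' * w e') / c e0" using e0 by (simp add: field_simps)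
    also have "\<dots> = (\<Sum>e'\<in>E - E1. L e' * w e')"
      by (simp add: L_def sum_divide_distrib sum_negf)
    finally have we0: "w e0 = (\<Sum>e'\<in>E - E1. L e' * w e')" .
    show "w e = (\<Sum>e'\<in>E - E1. M1 e e' * w e')"
    proof (cases "e = e0")
      case True
      then show ?thesis using we0 by (simp add: M1_def)
    next
      case False
      then have "w e = (\<Sum>e'\<in>E - E0. M e e' * w e')" using sol[OF w'] e by (simp add: E1_def)
      also have "\<dots> = M e e0 * w e0 + (\<Sum>e'\<in>E - E1. M e e' * w e')" using EE fE1 by simp
      also have "\<dots> = (\<Sum>e'\<in>E - E1. M1 e e' * w e')"
        unfolding we0 using False
        by (simp add: M1_def sum_distrib_left distrib_right sum.distrib mult.assoc)
      finally show ?thesis .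
    qed
  qed
qed

text \<open>Monomials of degree at most \<open>s\<close>; \<^const>\<open>None\<close> stands for the factor \<open>1\<close>.\<close>

definition feature :: "nat \<Rightarrow> ('d \<Rightarrow> real) \<Rightarrow> (nat \<Rightarrow> 'd option) \<Rightarrow> real" where
  "feature s z e = (\<Prod>j<s. case e j of None \<Rightarrow> 1 | Some d \<Rightarrow> z d)"

definition features :: "nat \<Rightarrow> 'd set \<Rightarrow> (nat \<Rightarrow> 'd option) set" where
  "features s I = {..<s} \<rightarrow>\<^sub>E insert None (Some ` I)"

lemma finite_features: "finite I \<Longrightarrow> finite (features s I)"
  unfolding features_def by (intro finite_PiE) auto

text \<open>For each \<open>q\<close> some affine function of one coordinate is 1 at
  \<open>y\<close> and 0 at \<open>q\<close>. The product of these functions, filled up to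
  \<open>s\<close> factors by the constant 1, expands into features.\<close>

lemma feature_interpolation:
  fixes y :: "'d \<Rightarrow> real"
  assumes I: "finite I" and Q: "finite Q" "card Q \<le> s"
    and ne: "\<And>q. q \<in> Q \<Longrightarrow> \<exists>d\<in>I. q d \<noteq> y d"
  shows "\<exists>v. (\<Sum>e\<in>features s I. v e * feature s y e) = 1
    \<and> (\<forall>q\<in>Q. (\<Sum>e\<in>features s I. v e * feature s q e) = 0)"
proof -
  obtain h where h: "Q = h ` {..<card Q}"
    using ex_bij_betw_nat_finite[OF Q(1)] by (auto simp: bij_betw_def atLeast0LessThan)
  have "\<forall>q\<in>Q. \<exists>d\<in>I. q d \<noteq> y d" using ne by blast
  then obtain D where D: "\<And>q. q \<in> Q \<Longrightarrow> D q \<in> I" "\<And>q. q \<in> Q \<Longrightarrow> q (D q) \<noteq> y (D q)" by metis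
  \<comment> \<open>Coefficients of the \<open>j\<close>-th factor
    \<open>(z d - q d) / (y d - q d)\<close>, where \<open>d\<close> is a coordinate in which
    \<open>q = h j\<close> differs from \<open>y\<close>.\<close>
  define c where "c j (x :: 'd option) = (if j < card Q then
      (let q = h j; d = D q in
        if x = Some d then 1 / (y d - q d) else if x = None then - q d / (y d - q d) else 0)
      else if x = None then 1 else 0)" for j x
  define val where "val (z :: 'd \<Rightarrow> real) x = (case x of None \<Rightarrow> 1 | Some d \<Rightarrow> z d)" for z x
  have hQ: "h j \<in> Q" if "j < card Q" for j using that h by blast
  have sumc: "(\<Sum>x\<in>insert None (Some ` I). c j x * val z x)
      = (if j < card Q then (z (D (h j)) - h j (D (h j))) / (y (D (h j)) - h j (D (h j))) else 1)" for j z
  proof (cases "j < card Q")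
    case True
    have "(\<Sum>x\<in>insert None (Some ` I). c j x * val z x) = (\<Sum>x\<in>{None, Some (D (h j))}. c j x * val z x)"
      using I D(1)[OF hQ[OF True]] True by (intro sum.mono_neutral_right) (auto simp: c_def Let_def)
    also have "\<dots> = (z (D (h j)) - h j (D (h j))) / (y (D (h j)) - h j (D (h j)))"
      using True by (simp add: c_def Let_def val_def diff_divide_distrib)
    finally show ?thesis using True by simp
  next
    case False
    then have "(\<Sum>x\<in>insert None (Some ` I). c j x * val z x) = (\<Sum>x\<in>{None}. c j x * val z x)"
      using I by (intro sum.mono_neutral_right) (auto simp: c_def)
    then show ?thesis using False by (simp add: c_def val_def)
  qed
  have ne0: "y (D (h j)) \<noteq> h j (D (h j))" if "j < card Q" for j using D(2)[OF hQ[OF that]] by simp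
  define v where "v e = (\<Prod>j<s. c j (e j))" for e
  have "(\<Sum>e\<in>features s I. v e * feature s z e) = (\<Prod>j<s. \<Sum>x\<in>insert None (Some ` I). c j x * val z x)" for z
    unfolding features_def feature_def v_def prod.distrib[symmetric] val_def
    using I by (subst prod_sum_PiE) auto
  note eval = this[unfolded sumc]
  have "(\<Sum>e\<in>features s I. v e * feature s y e) = 1"
    unfolding eval using ne0 by (intro prod.neutral) auto
  moreover have "(\<Sum>e\<in>features s I. v e * feature s q e) = 0" if q: "q \<in> Q" for q
  proof -
    obtain j where j: "j < card Q" "q = h j" using q h by blast
    then show ?thesis unfolding eval using Q by (intro prod_zero) (auto intro!: bexI[of _ j])
  qed
  ultimately show ?thesis by blast
qed

text \<open>
  \<open>G\<close> does not satisfy \<open>n * card R\<close> equations \<open>G (y k) c = G (y' k) c\<close> at points that depend on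
  fewer than \<open>n * card R\<close> real parameters \<open>U\<close>. The disjointness of the two families of points makes the
  equations independent.
\<close>

definition generic_map :: "nat \<Rightarrow> nat \<Rightarrow> 'd set \<Rightarrow> (('d \<Rightarrow> real) \<Rightarrow> nat \<Rightarrow> real) \<Rightarrow> bool" where
  "generic_map n s I G \<longleftrightarrow>
    (\<forall>(R :: nat set) y y' U. finite R \<longrightarrow> 2 * card R \<le> s \<longrightarrow> finite U \<longrightarrow> card U < n * card R \<longrightarrow>
       (\<forall>k\<in>R. \<forall>d. y k d \<in> insert 0 U \<and> y' k d \<in> insert 0 U \<and> (d \<notin> I \<longrightarrow> y k d = 0 \<and> y' k d = 0)) \<longrightarrow>
       inj_on y R \<longrightarrow> y ` R \<inter> y' ` R = {} \<longrightarrow> (\<exists>k\<in>R. \<exists>c<n. G (y k) c \<noteq> G (y' k) c))"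

text \<open>All coefficients together are algebraically independent. If the equations held,
  elimination would express \<open>card R\<close> coefficients for each \<open>c < n\<close> through
  the others, over the field generated by \<open>U\<close>. The whole family would then lie in a
  field with \<open>card U + (card E - card R) * n\<close> generators, fewer than the
  \<open>card E * n\<close> coefficients.\<close>

lemma generic_coefficients_ex:
  fixes W0 :: "(nat \<Rightarrow> 'd option) \<Rightarrow> nat \<Rightarrow> real"
  assumes I: "finite I" and \<eta>: "\<eta> > 0"
  shows "\<exists>W. (\<forall>e\<in>features s I. \<forall>c<n. \<bar>W e c - W0 e c\<bar> < \<eta>) \<and>
    generic_map n s I (\<lambda>z c. \<Sum>e\<in>features s I. W e c * feature s z e)"
proof -
  define E where "E = features s I"
  have fE: "finite E" using finite_features[OF I] by (simp add: E_def)
  define m where "m = card (E \<times> {..<n})"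
  obtain g where g: "bij_betw g {..<m} (E \<times> {..<n})"
    using ex_bij_betw_nat_finite[of "E \<times> {..<n}"] fE by (auto simp: m_def atLeast0LessThan)
  obtain w where w: "\<And>i. i < m \<Longrightarrow> \<bar>w i - W0 (fst (g i)) (snd (g i))\<bar> < \<eta>" and ind: "alg_indep m w"
    using alg_indep_near_ex[OF \<eta>, of m "\<lambda>i. W0 (fst (g i)) (snd (g i))"] by blast
  define W where "W e c = w (the_inv_into {..<m} g (e, c))" for e c
  have Wg: "W (fst (g i)) (snd (g i)) = w i" if "i < m" for i
    using that g by (simp add: W_def the_inv_into_f_f bij_betw_def)
  have near: "\<bar>W e c - W0 e c\<bar> < \<eta>" if "e \<in> E" "c < n" for e c
  proof -
    have "(e, c) \<in> g ` {..<m}" using g that by (simp add: bij_betw_def)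
    then obtain i where "i < m" "g i = (e, c)" by auto
    then show ?thesis using w[of i] Wg[of i] by simp
  qed
  have gen: "\<exists>k\<in>R. \<exists>c<n. (\<Sum>e\<in>E. W e c * feature s (y k) e) \<noteq> (\<Sum>e\<in>E. W e c * feature s (y' k) e)"
    if fR: "finite R" and R: "2 * card R \<le> s" and U: "finite U" "card U < n * card R"
      and mem: "\<forall>k\<in>R. \<forall>d. y k d \<in> insert 0 U \<and> y' k d \<in> insert 0 U \<and> (d \<notin> I \<longrightarrow> y k d = 0 \<and> y' k d = 0)"
      and inj: "inj_on y R" and disj: "y ` R \<inter> y' ` R = {}"
    for R :: "nat set" and y y' U
  proof (rule ccontr)
    assume "\<not> ?thesis"
    then have eq: "\<And>k c. k \<in> R \<Longrightarrow> c < n \<Longrightarrow>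
        (\<Sum>e\<in>E. W e c * feature s (y k) e) = (\<Sum>e\<in>E. W e c * feature s (y' k) e)" by blast
    define r where "r = card R"
    obtain \<rho> where \<rho>: "bij_betw \<rho> {..<r} R"
      using ex_bij_betw_nat_finite[OF fR] by (auto simp: r_def atLeast0LessThan)
    have \<rho>R: "\<rho> i \<in> R" if "i < r" for i using \<rho> that by (auto simp: bij_betw_def)
    define f where "f i e = feature s (y (\<rho> i)) e - feature s (y' (\<rho> i)) e" for i e
    have feF: "feature s z e \<in> gen_field U" if "\<And>d. z d \<in> insert 0 U" for z e
    proof -
      have "z d \<in> gen_field U" for d
        using that[of d] by (auto simp: gen_field_zero intro: gen_field.base)
      then show ?thesis
        unfolding feature_def by (intro gen_field_prod) (auto split: option.split intro: gen_field.one)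
    qed
    have fF: "f i e \<in> gen_field U" if "i < r" "e \<in> E" for i e
      unfolding f_def using mem \<rho>R[OF that(1)] by (intro gen_field.diff feF) auto
    \<comment> \<open>Up to \<open>2 * card R\<close> points occur, whence the hypothesis on the
      degree \<open>s\<close>. The interpolating coefficients are the dual vectors for the forms
      \<open>f i\<close>.\<close>
    have "\<exists>v. (\<Sum>e\<in>features s I. v e * feature s (y (\<rho> j)) e) = 1
       \<and> (\<forall>q\<in>(y ` R \<union> y' ` R) - {y (\<rho> j)}. (\<Sum>e\<in>features s I. v e * feature s q e) = 0)" if j: "j < r" for j
    proof (rule feature_interpolation[OF I])
      show "finite ((y ` R \<union> y' ` R) - {y (\<rho> j)})" using fR by simp
      have "card ((y ` R \<union> y' ` R) - {y (\<rho> j)}) \<le> card (y ` R \<union> y' ` R)"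
        using fR by (intro card_mono) auto
      also have "\<dots> \<le> card R + card R"
        by (intro order_trans[OF card_Un_le] add_mono card_image_le fR)
      finally show "card ((y ` R \<union> y' ` R) - {y (\<rho> j)}) \<le> s" using R by simp
      fix q assume q: "q \<in> (y ` R \<union> y' ` R) - {y (\<rho> j)}"
      then obtain d where d: "q d \<noteq> y (\<rho> j) d" by (auto simp: fun_eq_iff)
      moreover have "d \<in> I"
      proof (rule ccontr)
        assume "d \<notin> I"
        then have "q d = 0" "y (\<rho> j) d = 0" using q mem \<rho>R[OF j] by auto
        then show False using d by simp
      qed
      ultimately show "\<exists>d\<in>I. q d \<noteq> y (\<rho> j) d" by blast
    qed
    then have "\<forall>j\<in>{..<r}. \<exists>v. (\<Sum>e\<in>E. v e * feature s (y (\<rho> j)) e) = 1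
       \<and> (\<forall>q\<in>(y ` R \<union> y' ` R) - {y (\<rho> j)}. (\<Sum>e\<in>E. v e * feature s q e) = 0)"
      unfolding E_def by blast
    then obtain v where v: "\<forall>j\<in>{..<r}. (\<Sum>e\<in>E. v j e * feature s (y (\<rho> j)) e) = 1
       \<and> (\<forall>q\<in>(y ` R \<union> y' ` R) - {y (\<rho> j)}. (\<Sum>e\<in>E. v j e * feature s q e) = 0)"
      by (rule bchoice[THEN exE])
    then have v1: "\<And>j. j < r \<Longrightarrow> (\<Sum>e\<in>E. v j e * feature s (y (\<rho> j)) e) = 1"
      and v0: "\<And>j q. j < r \<Longrightarrow> q \<in> (y ` R \<union> y' ` R) - {y (\<rho> j)} \<Longrightarrow> (\<Sum>e\<in>E. v j e * feature s q e) = 0"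
      by blast+
    have dual: "(\<Sum>e\<in>E. f i e * v j e) = (if i = j then 1 else 0)" if i: "i < r" and j: "j < r" for i j
    proof -
      have "(\<Sum>e\<in>E. f i e * v j e)
          = (\<Sum>e\<in>E. v j e * feature s (y (\<rho> i)) e) - (\<Sum>e\<in>E. v j e * feature s (y' (\<rho> i)) e)"
        by (simp add: f_def algebra_simps sum_subtractf)
      also have "(\<Sum>e\<in>E. v j e * feature s (y' (\<rho> i)) e) = 0"
        using disj \<rho>R i j by (intro v0) auto
      also have "(\<Sum>e\<in>E. v j e * feature s (y (\<rho> i)) e) = (if i = j then 1 else 0)"
      proof (cases "i = j")
        case False
        then have "y (\<rho> i) \<noteq> y (\<rho> j)"
          using inj \<rho> i j by (auto simp: bij_betw_def inj_on_def)
        then show ?thesis using False v0[OF j, of "y (\<rho> i)"] \<rho>R[OF i] by auto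
      qed (simp add: v1 j)
      finally show ?thesis by simp
    qed
    obtain E0 M where "solves_forms U E f r E0 M"
      using eliminate_forms[OF fE, of r f U v] fF dual by blast
    then have E0: "E0 \<subseteq> E" "card E0 = r"
      and M: "\<forall>e\<in>E0. \<forall>e'\<in>E - E0. M e e' \<in> gen_field U"
      and sol: "\<forall>w. (\<forall>i<r. (\<Sum>e\<in>E. f i e * w e) = 0) \<longrightarrow> (\<forall>e\<in>E0. w e = (\<Sum>e'\<in>E - E0. M e e' * w e'))"
      unfolding solves_forms_def by blast+
    \<comment> \<open>The parameters and the coefficients at non-pivot features.\<close>
    define S where "S = U \<union> (\<lambda>(e, c). W e c) ` ((E - E0) \<times> {..<n})"
    have fS: "finite S" using U fE by (simp add: S_def)
    have "m \<le> card S"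
    proof (rule alg_indep_le_generators[OF ind fS])
      fix i assume i: "i < m"
      obtain e c where ec: "g i = (e, c)" by fastforce
      have "g i \<in> E \<times> {..<n}" using bij_betwE[OF g] i by blast
      then have e: "e \<in> E" and c: "c < n" using ec by auto
      have base: "W e' c \<in> gen_field S" if "e' \<in> E - E0" for e'
        using that c by (intro gen_field.base) (auto simp: S_def)
      have "W e c \<in> gen_field S"
      proof (cases "e \<in> E0")
        case True
        have "(\<Sum>e\<in>E. f i e * W e c) = 0" if "i < r" for i
          using eq[OF \<rho>R[OF that] c] by (simp add: f_def algebra_simps sum_subtractf)
        then have "W e c = (\<Sum>e'\<in>E - E0. M e e' * W e' c)" using sol True by (elim allE[where x = "\<lambda>e. W e c"]) auto
        also have "\<dots> \<in> gen_field S"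
          using M True base by (intro gen_field_sum gen_field.mult) (auto intro: gen_field_mono simp: S_def)
        finally show ?thesis .
      qed (use base e in auto)
      then show "w i \<in> gen_field S" using Wg[OF i] ec by simp
    qed
    also have "card S \<le> card U + card ((E - E0) \<times> {..<n})"
      unfolding S_def using fE by (intro order_trans[OF card_Un_le] add_mono card_image_le) auto
    also have "card ((E - E0) \<times> {..<n}) = (card E - r) * n"
      using E0 fE by (simp add: card_Diff_subset finite_subset)
    finally have "card E * n \<le> card U + (card E - r) * n" by (simp add: m_def card_cartesian_product)
    moreover have "r \<le> card E" using E0 fE card_mono by metis
    then have "card E * n = (card E - r) * n + r * n" by (simp flip: distrib_right)
    ultimately show False using U(2) by (simp add: r_def mult.commute)
  qed
  show ?thesis
    unfolding E_def[symmetric] generic_map_def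
    by (intro exI[of _ W] conjI allI impI ballI; (rule near | rule gen); assumption)
qed

section \<open>Separating words of bounded weight\<close>

text \<open>In a minimal edge cover every edge has an endpoint that no other edge covers.\<close>

lemma private_endpoints:
  fixes a b :: "'k \<Rightarrow> 'v"
  assumes fin: "finite K" and ne: "\<And>k. k \<in> K \<Longrightarrow> a k \<noteq> b k"
  shows "\<exists>R\<subseteq>K. \<exists>y y'. card (a ` K \<union> b ` K) \<le> 2 * card R
     \<and> (\<forall>k\<in>R. y k = a k \<and> y' k = b k \<or> y k = b k \<and> y' k = a k)
     \<and> inj_on y R \<and> y ` R \<inter> y' ` R = {}"
proof -
  define cov where "cov R \<longleftrightarrow> R \<subseteq> K \<and> a ` R \<union> b ` R = a ` K \<union> b ` K" for R
  have "cov K" by (simp add: cov_def)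
  then obtain R where R: "cov R" and min: "\<And>R'. cov R' \<Longrightarrow> card R \<le> card R'"
    using ex_has_least_nat[of cov K card] by blast
  have fR: "finite R" using R fin finite_subset by (auto simp: cov_def)
  have "\<exists>y\<in>{a k, b k}. y \<notin> a ` (R - {k}) \<union> b ` (R - {k})" if k: "k \<in> R" for k
  proof (rule ccontr)
    assume "\<not> ?thesis"
    then have "cov (R - {k})" using R k unfolding cov_def by blast
    then have "card R \<le> card (R - {k})" by (rule min)
    then show False using k fR card_Diff1_less[of R k] by simp
  qed
  then obtain y where y: "\<And>k. k \<in> R \<Longrightarrow> y k \<in> {a k, b k}"
    "\<And>k. k \<in> R \<Longrightarrow> y k \<notin> a ` (R - {k}) \<union> b ` (R - {k})" by metis
  define y' where "y' k = (if y k = a k then b k else a k)" for k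
  have yy: "y k = a k \<and> y' k = b k \<or> y k = b k \<and> y' k = a k" if "k \<in> R" for k
    using y(1)[OF that] by (auto simp: y'_def)
  have "card (a ` K \<union> b ` K) \<le> card R + card R"
    using R fR unfolding cov_def by (metis (no_types, lifting) add_mono card_Un_le card_image_le le_trans)
  moreover have "inj_on y R"
  proof (rule inj_onI, rule ccontr)
    fix k l assume "k \<in> R" "l \<in> R" "y k = y l" "k \<noteq> l"
    then show False using y(1)[of l] y(2)[of k] by auto
  qed
  moreover have "y k \<noteq> y' l" if "k \<in> R" "l \<in> R" for k l
  proof (cases "k = l")
    case True
    have "a k \<noteq> b k" using R that ne by (auto simp: cov_def)
    then show ?thesis using yy[of k] that True by auto
  next
    case False
    then show ?thesis using y(2)[of k] yy[of l] that by auto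
  qed
  ultimately show ?thesis
    using R yy unfolding cov_def by (intro exI[of _ R] conjI exI[of _ y] exI[of _ y']) auto
qed

text \<open>The pairs \<open>a k\<close>, \<open>b k\<close> are the edges of a graph. A minimal
  edge cover with an oriented choice of endpoints meets the injectivity and disjointness conditions
  of \<open>generic_map\<close>, and has at least half as many edges as there are vertices; this is
  the factor 2 before \<open>card U\<close>.\<close>

lemma generic_map_edges:
  fixes a b :: "nat \<Rightarrow> 'd \<Rightarrow> real"
  assumes G: "generic_map n s I G" and K: "finite K" "2 * card K \<le> s"
    and ne: "\<And>k. k \<in> K \<Longrightarrow> a k \<noteq> b k"
    and U: "finite U" "2 * card U < n * card (a ` K \<union> b ` K)"
    and mem: "\<And>k d. k \<in> K \<Longrightarrow> a k d \<in> insert 0 U \<and> b k d \<in> insert 0 U"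
    and zero: "\<And>k d. k \<in> K \<Longrightarrow> d \<notin> I \<Longrightarrow> a k d = 0 \<and> b k d = 0"
  shows "\<exists>k\<in>K. \<exists>c<n. G (a k) c \<noteq> G (b k) c"
proof -
  obtain R y y' where R: "R \<subseteq> K" and card: "card (a ` K \<union> b ` K) \<le> 2 * card R"
    and yy: "\<And>k. k \<in> R \<Longrightarrow> y k = a k \<and> y' k = b k \<or> y k = b k \<and> y' k = a k"
    and inj: "inj_on y R" "y ` R \<inter> y' ` R = {}"
    using private_endpoints[where a = a and b = b, OF K(1) ne] by metis
  have fR: "finite R" "card R \<le> card K" using R K by (auto intro: finite_subset card_mono)
  have "n * card (a ` K \<union> b ` K) \<le> n * (2 * card R)" using card by simp
  then have cU: "card U < n * card R" using U by linarith
  have val: "\<forall>k\<in>R. \<forall>d. y k d \<in> insert 0 U \<and> y' k d \<in> insert 0 U \<and> (d \<notin> I \<longrightarrow> y k d = 0 \<and> y' k d = 0)"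
  proof (intro ballI allI)
    fix k d assume k: "k \<in> R"
    then have "k \<in> K" using R by blast
    then show "y k d \<in> insert 0 U \<and> y' k d \<in> insert 0 U \<and> (d \<notin> I \<longrightarrow> y k d = 0 \<and> y' k d = 0)"
      using mem[of k d] zero[of k d] yy[OF k] by metis
  qed
  have "2 * card R \<le> s" using fR K by simp
  then obtain k c where "k \<in> R" "c < n" "G (y k) c \<noteq> G (y' k) c"
    using G[unfolded generic_map_def, THEN spec, of R, THEN spec, of y, THEN spec, of y', THEN spec, of U]
      fR U(1) cU val inj by blast
  then show ?thesis using yy[of k] R by (metis subsetD)
qed

section \<open>Windows of words and the real parameters occurring in them\<close>

definition win :: "nat \<Rightarrow> (nat \<Rightarrow> 'v \<Rightarrow> real) \<Rightarrow> nat \<Rightarrow> nat \<times> 'v \<Rightarrow> real" where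
  "win L p k = (\<lambda>(j, v). if j < L then p (k + j) v else 0)"

lemma win_eqD: "win L p k = win L q l \<Longrightarrow> j < L \<Longrightarrow> p (k + j) = q (l + j)"
proof (rule ext)
  fix v assume eq: "win L p k = win L q l" and j: "j < L"
  have "win L p k (j, v) = win L q l (j, v)" by (simp only: eq)
  then show "p (k + j) v = q (l + j) v" using j by (simp add: win_def)
qed

definition weight :: "('v \<Rightarrow> real) \<Rightarrow> nat" where
  "weight u = card {v. u v \<noteq> 0}"

text \<open>These are the real parameters that a stretch of the word involves. Zero entries are left
  out because 0 lies in every field.\<close>

definition vals :: "(nat \<Rightarrow> 'v \<Rightarrow> real) \<Rightarrow> nat \<Rightarrow> nat \<Rightarrow> real set" where
  "vals p k t = (\<Union>i<t. p (k + i) ` {v. p (k + i) v \<noteq> 0})"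

lemma card_vals_le:
  assumes "\<And>k. finite {v. p k v \<noteq> 0}"
  shows "finite (vals p k t)" "card (vals p k t) \<le> (\<Sum>i<t. weight (p (k + i)))"
proof -
  show "finite (vals p k t)" using assms by (simp add: vals_def)
  have "card (vals p k t) \<le> (\<Sum>i<t. card (p (k + i) ` {v. p (k + i) v \<noteq> 0}))"
    unfolding vals_def by (rule card_UN_le) simp
  also have "\<dots> \<le> (\<Sum>i<t. weight (p (k + i)))"
    unfolding weight_def using assms by (intro sum_mono card_image_le)
  finally show "card (vals p k t) \<le> (\<Sum>i<t. weight (p (k + i)))" .
qed

lemma sum_blocks_le:
  fixes c :: "nat \<Rightarrow> nat"
  assumes "\<And>k. (\<Sum>i<N. c (k + i)) \<le> D * N"
  shows "(\<Sum>i<m * N. c (k + i)) \<le> D * (m * N)"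
proof (induction m)
  case (Suc m)
  have "(\<Sum>i<m * N + l. c (k + i)) = (\<Sum>i<m * N. c (k + i)) + (\<Sum>i<l. c (k + m * N + i))" for l
    by (induction l) (auto simp: add.assoc)
  from this[of N] show ?case
    using Suc assms[of "k + m * N"] by (simp add: add.commute distrib_left)
qed simp

text \<open>For \<open>t < N\<close>, \<open>N\<close> consecutive periods make up \<open>t\<close>
  whole blocks, so one period inherits the average. For \<open>t \<ge> N\<close>, one period is
  covered by \<open>t div N + 1\<close> blocks of total length at most \<open>2 * t\<close>, which
  is where the factor 2 comes from.\<close>

lemma sum_period_le:
  fixes c :: "nat \<Rightarrow> nat"
  assumes N: "N \<ge> 1" and blocks: "\<And>k. (\<Sum>i<N. c (k + i)) \<le> D * N"
    and t: "t \<ge> 1" and per: "\<And>i. i < t * N \<Longrightarrow> t < N \<Longrightarrow> c (k + i) = c (k + i mod t)"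
  shows "(\<Sum>i<t. c (k + i)) \<le> 2 * D * t"
proof (cases "t < N")
  case True
  have "(\<Sum>i<m * t. c (k + i mod t)) = m * (\<Sum>i<t. c (k + i))" for m
  proof (induction m)
    case (Suc m)
    have "(\<Sum>i<m * t + l. c (k + i mod t)) = (\<Sum>i<m * t. c (k + i mod t)) + (\<Sum>i<l. c (k + i))"
      if "l \<le> t" for l
      using that by (induction l) auto
    from this[of t] show ?case using Suc by (simp add: add.commute)
  qed simp
  from this[of N] have "N * (\<Sum>i<t. c (k + i)) = (\<Sum>i<t * N. c (k + i mod t))"
    by (simp add: mult.commute)
  also have "\<dots> = (\<Sum>i<t * N. c (k + i))" using per True by (intro sum.cong) auto
  also have "\<dots> \<le> D * (t * N)" by (rule sum_blocks_le[OF blocks])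
  finally have "N * (\<Sum>i<t. c (k + i)) \<le> N * (D * t)" by (simp add: mult_ac)
  then have "(\<Sum>i<t. c (k + i)) \<le> D * t" using N by simp
  then show ?thesis by simp
next
  case False
  define m where "m = t div N + 1"
  have m: "t \<le> m * N" "m * N \<le> 2 * t"
    using False N by (auto simp: m_def dividend_less_div_times less_imp_le add.commute
        intro: order_trans[OF add_mono[OF _ div_times_less_eq_dividend]])
  have "(\<Sum>i<t. c (k + i)) \<le> (\<Sum>i<m * N. c (k + i))" using m by (intro sum_mono2) auto
  also have "\<dots> \<le> D * (m * N)" by (rule sum_blocks_le[OF blocks])
  also have "\<dots> \<le> D * (2 * t)" using m by simp
  finally show ?thesis by simp
qed

section \<open>Words that are periodic on the positions from \<open>B\<close> below
  \<open>4 * B\<close>\<close>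

definition per :: "nat \<Rightarrow> (nat \<Rightarrow> 'b) \<Rightarrow> nat \<Rightarrow> bool" where
  "per B p t \<longleftrightarrow> t \<ge> 1 \<and> (\<forall>m. B \<le> m \<longrightarrow> m + t < 4 * B \<longrightarrow> p (m + t) = p m)"

lemma per_base:
  assumes "per B p t"
  shows "B + i < 4 * B \<Longrightarrow> p (B + i) = p (B + i mod t)"
proof (induction i rule: less_induct)
  case (less i)
  show ?case
  proof (cases "i < t")
    case False
    have t: "t \<ge> 1" using assms by (simp add: per_def)
    have "B + (i - t) + t < 4 * B" using False less.prems by simp
    then have "p (B + (i - t) + t) = p (B + (i - t))"
      using assms unfolding per_def by (meson le_add1)
    moreover have "B + (i - t) + t = B + i" using False by simp
    ultimately have "p (B + i) = p (B + (i - t))" by metis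
    also have "\<dots> = p (B + (i - t) mod t)" using less.prems False t by (intro less.IH) auto
    also have "(i - t) mod t = i mod t" using False by (simp add: le_mod_geq)
    finally show ?thesis .
  qed simp
qed

lemma per_cong:
  assumes "per B p t" "i mod t = j mod t" "B + i < 4 * B" "B + j < 4 * B"
  shows "p (B + i) = p (B + j)"
  using per_base[OF assms(1)] assms by simp

text \<open>Equal windows starting at \<open>i < j \<le> B\<close> match the word with its shift by
  \<open>j - i\<close> over a length of \<open>4 * B\<close>, which reaches every position from
  \<open>B\<close> on that is needed.\<close>

lemma repeated_window_per:
  assumes "\<not> inj_on (win (4 * B) p) {..B}"
  shows "\<exists>t\<le>B. per B p t"
proof -
  obtain i j where ij: "i < j" "j \<le> B" "win (4 * B) p i = win (4 * B) p j"
    using assms unfolding inj_on_def by (metis atMost_iff linorder_neqE_nat)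
  have "per B p (j - i)"
    unfolding per_def
  proof (intro conjI allI impI)
    show "1 \<le> j - i" using ij by simp
    fix m assume m: "B \<le> m" "m + (j - i) < 4 * B"
    have "p (i + (m - i)) = p (j + (m - i))"
      using m ij by (intro win_eqD[OF ij(3)]) auto
    moreover have "i + (m - i) = m" "j + (m - i) = m + (j - i)" using m ij by auto
    ultimately show "p (m + (j - i)) = p m" by metis
  qed
  then show ?thesis using ij by (intro exI[of _ "j - i"]) auto
qed

text \<open>Equal windows at distance \<open>d < t\<close> contain a full period, since
  \<open>t \<le> 2 * B\<close>. So their equality spreads to the whole stretch by
  \<open>t\<close>-periodicity, and \<open>d\<close> would be a smaller period.\<close>

lemma least_per_inj:
  assumes per: "per B p t" and t: "t \<le> B" and least: "\<And>u. per B p u \<Longrightarrow> t \<le> u"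
  shows "inj_on (win (2 * B) p) {B..<B + t}"
proof (rule linorder_inj_onI')
  fix k k' assume k: "k \<in> {B..<B + t}" "k' \<in> {B..<B + t}" "k < k'"
  show "win (2 * B) p k \<noteq> win (2 * B) p k'"
  proof
    assume eq: "win (2 * B) p k = win (2 * B) p k'"
    obtain l where l: "k = B + l" "l < t" using k by (metis add_less_cancel_left atLeastLessThan_iff le_Suc_ex)
    define d where "d = k' - k"
    have d: "1 \<le> d" "d < t" "k' = k + d" using k by (auto simp: d_def)
    have "per B p d"
      unfolding per_def
    proof (intro conjI allI impI)
      fix m assume m: "B \<le> m" "m + d < 4 * B"
      obtain i where i: "m = B + i" using m le_Suc_ex by blast
      \<comment> \<open>Modulo \<open>t\<close>, position \<open>m\<close> is position
        \<open>x\<close> of the window starting at \<open>k\<close>. The summand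
        \<open>l * t\<close> keeps the subtraction from being truncated.\<close>
      define x where "x = (i + l * t - l) mod t"
      have xt: "x < t" unfolding x_def using d by (intro mod_less_divisor) auto
      have "(l + x) mod t = (l + (i + l * t - l)) mod t" unfolding x_def by (rule mod_add_right_eq)
      also have "l + (i + l * t - l) = i + l * t"
        using d l by (cases t) auto
      finally have c: "(l + x) mod t = i mod t" by simp
      have "p (B + i) = p (B + (l + x))"
        using per_cong[OF per c[symmetric]] m i xt t l by auto
      moreover have "p (B + (i + d)) = p (B + (l + x + d))"
        using per_cong[OF per mod_add_cong[OF c[symmetric] refl], of d] m i xt t l d k by auto
      moreover have "p (k + x) = p (k' + x)" using xt t by (intro win_eqD[OF eq]) auto
      ultimately show "p (m + d) = p m" using i l d by (simp add: add_ac)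
    qed (use d in auto)
    then show False using least[of d] d by simp
  qed
qed

text \<open>A case of the theorem of Fine and Wilf.\<close>

lemma periodic_agree:
  assumes p: "per B p t" "t \<le> B" and q: "per B q t'" "t' \<le> B"
    and k: "B \<le> k" "k \<le> 2 * B"
    and eq: "\<And>j. j < 2 * B \<Longrightarrow> p (k + j) = q (k + j)"
  shows "p B = q B"
proof -
  obtain l where l: "k = B + l" using k le_Suc_ex by blast
  \<comment> \<open>The agreement is pushed to the left one position at a time, down to
    \<open>B\<close>.\<close>
  have "B + l \<le> 2 * B \<Longrightarrow> (\<And>j. j < 2 * B \<Longrightarrow> p (B + l + j) = q (B + l + j)) \<Longrightarrow> p B = q B"
  proof (induction l)
    case 0
    have "0 < 2 * B" using p by (auto simp: per_def)
    then show ?case using "0.prems"(2)[of 0] by simp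
  next
    case (Suc l)
    define m where "m = B + l"
    have m: "B \<le> m" "m < 2 * B" using Suc.prems by (auto simp: m_def)
    have t: "t \<ge> 1" "t' \<ge> 1" using p q by (auto simp: per_def)
    have pp: "p (i + t) = p i" if "B \<le> i" "i + t < 4 * B" for i using p that by (simp add: per_def)
    have qq: "q (i + t') = q i" if "B \<le> i" "i + t' < 4 * B" for i using q that by (simp add: per_def)
    have eq: "p (m + i) = q (m + i)" if "1 \<le> i" "i \<le> 2 * B" for i
      using Suc.prems(2)[of "i - 1"] that by (simp add: m_def)
    \<comment> \<open>The detour goes forward by \<open>t\<close> in \<open>p\<close> and by
      \<open>t'\<close> in \<open>q\<close>, then back by \<open>t\<close> in \<open>p\<close> and
      by \<open>t'\<close> in \<open>q\<close>. The words are exchanged only at positions from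
      \<open>m + 1\<close> to \<open>m + 2 * B\<close>, where they agree.\<close>
    have "p m = p (m + t)" using pp[of m] m p by simp
    also have "\<dots> = q (m + t)" using eq[of t] t p by simp
    also have "\<dots> = q (m + t + t')" using qq[of "m + t"] m p q by simp
    also have "\<dots> = p (m + t' + t)" using eq[of "t + t'"] t p q by (simp add: add_ac)
    also have "\<dots> = p (m + t')" using pp[of "m + t'"] m p q by simp
    also have "\<dots> = q (m + t')" using eq[of t'] t q by simp
    also have "\<dots> = q m" using qq[of m] m q by simp
    finally have pm: "p m = q m" .
    show ?case
    proof (rule Suc.IH)
      fix j assume "j < 2 * B"
      then show "p (B + l + j) = q (B + l + j)"
        using pm eq[of j] by (cases "j = 0") (auto simp: m_def)
    qed (use Suc.prems in simp)
  qed
  then show ?thesis using k eq l by simp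
qed

text \<open>
  If \<open>B + 1\<close> successive long windows of one word are distinct, they suffice: the words have at most
  \<open>10 * D * B\<close> nonzero parameters and there are at least \<open>(B + 1) / 2\<close> independent equations per coordinate,
  so \<open>20 * D\<close> coordinates would already do. Otherwise both words are periodic from \<open>B\<close> to \<open>4 * B\<close>; then the
  number of parameters is proportional to the periods, and so is the number of distinct short windows.
\<close>

lemma words_separated:
  fixes p q :: "nat \<Rightarrow> 'v \<Rightarrow> real"
  assumes V: "finite V" "\<And>k v. v \<notin> V \<Longrightarrow> p k v = 0" "\<And>k v. v \<notin> V \<Longrightarrow> q k v = 0"
    and N: "N \<ge> 1" and D: "D \<ge> 1"
    and wp: "\<And>k. (\<Sum>i<N. weight (p (k + i))) \<le> D * N"
    and wq: "\<And>k. (\<Sum>i<N. weight (q (k + i))) \<le> D * N"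
    and B: "B = N * N" and pq: "p B \<noteq> q B"
    and G: "generic_map (21 * D) (2 * (B + 1)) ({..<4 * B} \<times> V) G"
    and H: "generic_map (21 * D) (2 * (B + 1)) ({..<2 * B} \<times> V) H"
  shows "\<exists>k. \<exists>c<21 * D. G (win (4 * B) p k) c \<noteq> G (win (4 * B) q k) c
                    \<or> H (win (2 * B) p k) c \<noteq> H (win (2 * B) q k) c"
proof -
  have B1: "B \<ge> 1" using N B by (simp add: Suc_le_eq)
  have fp: "finite {v. p k v \<noteq> 0}" for k by (rule finite_subset[OF _ V(1)]) (use V(2) in blast)
  have fq: "finite {v. q k v \<noteq> 0}" for k by (rule finite_subset[OF _ V(1)]) (use V(3) in blast)
  have zero: "win L p k d = 0 \<and> win L q k d = 0" if "d \<notin> {..<L} \<times> V" for L k d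
    using that V by (auto simp: win_def split: prod.split)
  show ?thesis
  proof (cases "inj_on (win (4 * B) p) {..B} \<or> inj_on (win (4 * B) q) {..B}")
    case True
    \<comment> \<open>Windows of length \<open>4 * B\<close> that start at most at \<open>B\<close>
      end before \<open>5 * B\<close>, which is a multiple of \<open>N\<close>.\<close>
    define U where "U = vals p 0 (5 * B) \<union> vals q 0 (5 * B)"
    have "(\<Sum>i<5 * N * N. weight (p (0 + i))) \<le> D * (5 * N * N)"
      "(\<Sum>i<5 * N * N. weight (q (0 + i))) \<le> D * (5 * N * N)"
      by (rule sum_blocks_le[OF wp], rule sum_blocks_le[OF wq])
    then have "card (vals p 0 (5 * B)) \<le> D * (5 * B)" "card (vals q 0 (5 * B)) \<le> D * (5 * B)"
      using card_vals_le(2)[of p 0 "5 * B", OF fp] card_vals_le(2)[of q 0 "5 * B", OF fq]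
      by (auto simp: B mult.assoc)
    then have "card U \<le> D * (5 * B) + D * (5 * B)"
      unfolding U_def by (meson add_mono card_Un_le le_trans)
    then have "2 * card U \<le> 20 * D * B" by simp
    also have "\<dots> < 21 * D * (B + 1)" using D by (simp add: add_strict_increasing2)
    also have "B + 1 \<le> card (win (4 * B) p ` {..B} \<union> win (4 * B) q ` {..B})"
    proof -
      have "card (win (4 * B) p ` {..B}) = B + 1 \<or> card (win (4 * B) q ` {..B}) = B + 1"
        using True by (auto simp: card_image)
      moreover have "card (win (4 * B) p ` {..B}) \<le> card (win (4 * B) p ` {..B} \<union> win (4 * B) q ` {..B})"
        "card (win (4 * B) q ` {..B}) \<le> card (win (4 * B) p ` {..B} \<union> win (4 * B) q ` {..B})"
        by (auto intro: card_mono)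
      ultimately show ?thesis by linarith
    qed
    finally have cU: "2 * card U < 21 * D * card (win (4 * B) p ` {..B} \<union> win (4 * B) q ` {..B})"
      by simp
    have "\<exists>k\<in>{..B}. \<exists>c<21 * D. G (win (4 * B) p k) c \<noteq> G (win (4 * B) q k) c"
    proof (rule generic_map_edges[OF G _ _ _ _ cU])
      show "finite U" unfolding U_def using card_vals_le(1)[of p, OF fp] card_vals_le(1)[of q, OF fq] by simp
      fix k assume k: "k \<in> {..B}"
      show "win (4 * B) p k \<noteq> win (4 * B) q k"
      proof
        assume "win (4 * B) p k = win (4 * B) q k"
        moreover have "B - k < 4 * B" using B1 by linarith
        ultimately have "p (k + (B - k)) = q (k + (B - k))" by (rule win_eqD)
        then show False using pq k by simp
      qed
      fix d
      show "win (4 * B) p k d \<in> insert 0 U \<and> win (4 * B) q k d \<in> insert 0 U"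
      proof -
        obtain j v where d: "d = (j, v)" by (cases d)
        have "k + j < 5 * B" if "j < 4 * B" using k that by simp
        then show ?thesis using d by (auto simp: win_def U_def vals_def intro!: bexI[of _ "k + j"])
      qed
    qed (use zero in auto)
    then show ?thesis by blast
  next
    case False
    define t where "t = (LEAST t. per B p t)"
    define t' where "t' = (LEAST t. per B q t)"
    obtain t0 t0' where t0: "t0 \<le> B" "per B p t0" "t0' \<le> B" "per B q t0'"
      using False repeated_window_per by meson
    have p: "per B p t" "t \<le> B" unfolding t_def using t0 by (auto intro: LeastI Least_le le_trans)
    have q: "per B q t'" "t' \<le> B" unfolding t'_def using t0 by (auto intro: LeastI Least_le le_trans)
    have t1: "t \<ge> 1" "t' \<ge> 1" using p q by (auto simp: per_def)
    have ip: "inj_on (win (2 * B) p) {B..<B + t}"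
      using p by (rule least_per_inj) (simp add: t_def Least_le)
    have iq: "inj_on (win (2 * B) q) {B..<B + t'}"
      using q by (rule least_per_inj) (simp add: t'_def Least_le)
    define U where "U = vals p B t \<union> vals q B t'"
    have perw: "(\<Sum>i<u. weight (r (B + i))) \<le> 2 * D * u"
      if "per B r u" "\<And>k. (\<Sum>i<N. weight (r (k + i))) \<le> D * N" for r :: "nat \<Rightarrow> 'v \<Rightarrow> real" and u
    proof (rule sum_period_le[OF N that(2)])
      show "1 \<le> u" using that by (simp add: per_def)
      \<comment> \<open>Here \<open>B = N * N\<close> enters: \<open>N\<close> periods shorter than
        \<open>N\<close> stay within the periodic stretch.\<close>
      fix i assume "i < u * N" "u < N"
      then have "i < B" unfolding B by (meson less_imp_le mult_le_mono1 order_less_le_trans)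
      then show "weight (r (B + i)) = weight (r (B + i mod u))"
        using per_base[OF that(1), of i] by simp
    qed
    have "card U \<le> 2 * D * t + 2 * D * t'"
      unfolding U_def using card_vals_le(2)[of p B t, OF fp] card_vals_le(2)[of q B t', OF fq]
        perw[OF p(1) wp] perw[OF q(1) wq] by (meson add_mono card_Un_le le_trans)
    \<comment> \<open>The starts run over a full least period of each word, so both periods are
      bounded by the number of distinct windows.\<close>
    define K where "K = {B..<B + max t t'}"
    define C where "C = card (win (2 * B) p ` K \<union> win (2 * B) q ` K)"
    have "card (win (2 * B) p ` {B..<B + t}) \<le> C"
      unfolding C_def by (intro card_mono) (auto simp: K_def)
    then have "t \<le> C" using card_image[OF ip] by simp
    moreover have "card (win (2 * B) q ` {B..<B + t'}) \<le> C"
      unfolding C_def by (intro card_mono) (auto simp: K_def)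
    then have "t' \<le> C" using card_image[OF iq] by simp
    ultimately have "2 * D * t + 2 * D * t' \<le> 2 * D * C + 2 * D * C" by (intro add_mono mult_le_mono2)
    then have "2 * card U \<le> 8 * D * C" using \<open>card U \<le> _\<close> by linarith
    also have "\<dots> < 21 * D * C" using D t1 \<open>t \<le> C\<close> by simp
    finally have cU: "2 * card U < 21 * D * card (win (2 * B) p ` K \<union> win (2 * B) q ` K)"
      by (simp add: C_def)
    have "\<exists>k\<in>K. \<exists>c<21 * D. H (win (2 * B) p k) c \<noteq> H (win (2 * B) q k) c"
    proof (rule generic_map_edges[OF H _ _ _ _ cU])
      show "finite K" "2 * card K \<le> 2 * (B + 1)" using p q by (auto simp: K_def)
      show "finite U" unfolding U_def using card_vals_le(1)[of p, OF fp] card_vals_le(1)[of q, OF fq] by simp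
      fix k assume "k \<in> K"
      then have k: "B \<le> k" "k < 2 * B" using p q by (auto simp: K_def)
      show "win (2 * B) p k \<noteq> win (2 * B) q k"
        using periodic_agree[OF p q, of k] k pq win_eqD[of "2 * B" p k q k] by (metis less_imp_le)
      fix d
      show "win (2 * B) p k d \<in> insert 0 U \<and> win (2 * B) q k d \<in> insert 0 U"
      proof -
        obtain j v where d: "d = (j, v)" by (cases d)
        have "p (k + j) v \<in> insert 0 U \<and> q (k + j) v \<in> insert 0 U" if j: "j < 2 * B"
        proof -
          obtain l where l: "k = B + l" using k le_Suc_ex by blast
          have "p (k + j) = p (B + (l + j) mod t)" "q (k + j) = q (B + (l + j) mod t')"
            using per_base[OF p(1), of "l + j"] per_base[OF q(1), of "l + j"] k j l
            by (auto simp: add.assoc)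
          moreover have "(l + j) mod t < t" "(l + j) mod t' < t'" using t1 by auto
          ultimately show ?thesis by (auto simp: U_def vals_def)
        qed
        then show ?thesis using d by (auto simp: win_def)
      qed
    qed (use zero in auto)
    then show ?thesis by blast
  qed
qed

section \<open>Invariant measures from orbit averages\<close>

text \<open>The points nearer to one set than to the other. Empty sets are treated apart, because
  the distance \<open>infdist\<close> to the empty set is 0.\<close>

lemma closed_separation:
  fixes S T :: "'a::metric_space set"
  assumes "closed S" "closed T" "S \<inter> T = {}"
  shows "\<exists>U V. open U \<and> open V \<and> S \<subseteq> U \<and> T \<subseteq> V \<and> U \<inter> V = {}"
proof (cases "S = {} \<or> T = {}")
  case True
  then show ?thesis
    by (metis Int_empty_left Int_empty_right empty_subsetI open_UNIV open_empty subset_UNIV)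
next
  case False
  define U where "U = {x. infdist x S < infdist x T}"
  define V where "V = {x. infdist x T < infdist x S}"
  have cont: "continuous_on UNIV (\<lambda>x. infdist x A)" for A :: "'a set"
    by (intro continuous_intros)
  have "open U" "open V" unfolding U_def V_def by (intro open_Collect_less cont)+
  moreover have "S \<subseteq> U" "T \<subseteq> V"
  proof -
    have *: "infdist x A = 0 \<and> infdist x B > 0" if "closed A" "closed B" "A \<inter> B = {}" "A \<noteq> {}" "B \<noteq> {}" "x \<in> A"
      for A B and x :: 'a
      using that in_closed_iff_infdist_zero[of A x] in_closed_iff_infdist_zero[of B x] infdist_nonneg[of x B]
      by (auto simp: less_le)
    show "S \<subseteq> U" using *[of S T] assms False by (auto simp: U_def)
    have "T \<inter> S = {}" using assms(3) by blast
    then show "T \<subseteq> V" using *[of T S] assms(1,2) False by (auto simp: V_def)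
  qed
  moreover have "U \<inter> V = {}" by (auto simp: U_def V_def)
  ultimately show ?thesis by blast
qed

text \<open>A finitely additive \<open>m\<close> is regularised as a content: open sets are measured
  from inside by closed sets, and then all sets from outside by open ones.\<close>

definition inner_content :: "('a::topological_space set \<Rightarrow> real) \<Rightarrow> 'a set \<Rightarrow> ennreal" where
  "inner_content m U = (SUP K\<in>{K. closed K \<and> K \<subseteq> U}. ennreal (m K))"

definition content_outer :: "('a::topological_space set \<Rightarrow> real) \<Rightarrow> 'a set \<Rightarrow> ennreal" where
  "content_outer m A = (INF U\<in>{U. open U \<and> A \<subseteq> U}. inner_content m U)"

text \<open>Cluster points of empirical measures have this form: defined and additive on all
  subsets, but possibly not countably additive.\<close>

locale finitely_additive_prob =
  fixes m :: "'a::metric_space set \<Rightarrow> real"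
  assumes compact_UNIV: "compact (UNIV :: 'a set)"
    and nonneg: "m A \<ge> 0" and total: "m UNIV = 1"
    and additive: "A \<inter> B = {} \<Longrightarrow> m (A \<union> B) = m A + m B"
begin

lemma mono: "A \<subseteq> B \<Longrightarrow> m A \<le> m B"
  using additive[of A "B - A"] nonneg[of "B - A"] by (simp add: Un_absorb1)

lemma subadditive: "m (A \<union> B) \<le> m A + m B"
  using additive[of A "B - A"] mono[of "B - A" B] by (simp add: Un_Diff_cancel)

lemma empty: "m {} = 0"
  using additive[of "{}" "{}"] by simp

lemma inner_content_ge: "closed K \<Longrightarrow> K \<subseteq> U \<Longrightarrow> ennreal (m K) \<le> inner_content m U"
  unfolding inner_content_def by (rule SUP_upper) simp

lemma inner_content_mono: "U \<subseteq> V \<Longrightarrow> inner_content m U \<le> inner_content m V"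
  unfolding inner_content_def by (rule SUP_subset_mono) auto

lemma inner_content_empty: "inner_content m {} = 0"
  unfolding inner_content_def by (auto simp: empty)

text \<open>A closed \<open>K\<close> in the union splits into closed parts inside \<open>U\<close>
  and \<open>V\<close>: disjoint open neighbourhoods of \<open>K - V\<close> and
  \<open>K - U\<close> are cut off in turn.\<close>

lemma inner_content_Un:
  assumes "open U" "open V"
  shows "inner_content m (U \<union> V) \<le> inner_content m U + inner_content m V"
  unfolding inner_content_def[of m "U \<union> V"]
proof (rule SUP_least)
  fix K assume "K \<in> {K. closed K \<and> K \<subseteq> U \<union> V}"
  then have K: "closed K" "K \<subseteq> U \<union> V" by auto
  have "(K - V) \<inter> (K - U) = {}" using K by blast
  then obtain S S' where S: "open S" "open S'" "K - V \<subseteq> S" "K - U \<subseteq> S'" "S \<inter> S' = {}"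
    using closed_separation[of "K - V" "K - U"] K assms by (auto simp: closed_Diff)
  have "m K \<le> m ((K - S') \<union> (K - S))" using S by (intro mono) auto
  also have "\<dots> \<le> m (K - S') + m (K - S)" by (rule subadditive)
  finally have "ennreal (m K) \<le> ennreal (m (K - S')) + ennreal (m (K - S))"
    by (simp add: nonneg flip: ennreal_plus)
  also have "\<dots> \<le> inner_content m U + inner_content m V"
    using K S by (intro add_mono inner_content_ge) (auto simp: closed_Diff)
  finally show "ennreal (m K) \<le> inner_content m U + inner_content m V" .
qed

lemma inner_content_UN_finite:
  fixes U :: "nat \<Rightarrow> 'a set"
  assumes "\<And>i. open (U i)"
  shows "inner_content m (\<Union>i<n. U i) \<le> (\<Sum>i<n. inner_content m (U i))"
proof (induction n)
  case (Suc n)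
  have "inner_content m (\<Union>i<Suc n. U i) \<le> inner_content m (U n) + inner_content m (\<Union>i<n. U i)"
    unfolding lessThan_Suc UN_insert using assms by (intro inner_content_Un) auto
  then show ?case using Suc by (simp add: add.commute order_trans add_left_mono)
qed (simp add: inner_content_empty)

text \<open>This is the source of countable subadditivity: a closed subset of the union is compact,
  so finitely many of the \<open>U i\<close> cover it.\<close>

lemma inner_content_UN:
  fixes U :: "nat \<Rightarrow> 'a set"
  assumes U: "\<And>i. open (U i)"
  shows "inner_content m (\<Union>i. U i) \<le> (\<Sum>i. inner_content m (U i))"
  unfolding inner_content_def[of m "\<Union>i. U i"]
proof (rule SUP_least)
  fix K assume "K \<in> {K. closed K \<and> K \<subseteq> (\<Union>i. U i)}"
  then have K: "closed K" "K \<subseteq> (\<Union>i. U i)" by auto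
  have "compact K" using compact_Int_closed[OF compact_UNIV K(1)] by simp
  then obtain C where C: "finite C" "K \<subseteq> (\<Union>i\<in>C. U i)"
    using compactE_image[of K UNIV U] K U by metis
  obtain n where n: "C \<subseteq> {..<n}" using C(1) finite_nat_iff_bounded by blast
  have "ennreal (m K) \<le> inner_content m (\<Union>i<n. U i)"
    using K C n by (intro inner_content_ge) blast+
  also have "\<dots> \<le> (\<Sum>i<n. inner_content m (U i))" by (rule inner_content_UN_finite[OF U])
  also have "\<dots> \<le> (\<Sum>i. inner_content m (U i))" by (rule sum_le_suminf) auto
  finally show "ennreal (m K) \<le> (\<Sum>i. inner_content m (U i))" .
qed

lemma content_outer_open: "open U \<Longrightarrow> content_outer m U = inner_content m U"
  unfolding content_outer_def
  by (intro antisym INF_lower INF_greatest) (auto intro: inner_content_mono)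

lemma content_outer_mono: "A \<subseteq> B \<Longrightarrow> content_outer m A \<le> content_outer m B"
  unfolding content_outer_def by (rule INF_superset_mono) auto

lemma content_outer_UNIV: "content_outer m UNIV = 1"
proof -
  have "inner_content m UNIV \<le> 1"
    unfolding inner_content_def
  proof (rule SUP_least)
    fix K :: "'a set"
    have "m K \<le> 1" using mono[of K UNIV] total by simp
    then show "ennreal (m K) \<le> 1" by simp
  qed
  moreover have "1 \<le> inner_content m UNIV" using inner_content_ge[of UNIV UNIV] total by simp
  ultimately show ?thesis unfolding content_outer_open[OF open_UNIV] by (rule antisym)
qed

text \<open>Every open superset of \<open>F\<close> has \<open>F\<close> among its closed subsets.
  This inequality is what carries lower bounds on \<open>m\<close> over to the measure, and it is
  the reason for working with closed supports.\<close>

lemma content_outer_closed: "closed F \<Longrightarrow> ennreal (m F) \<le> content_outer m F"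
  unfolding content_outer_def by (intro INF_greatest inner_content_ge) auto

lemma content_outer_le_one: "content_outer m A \<le> 1"
  using content_outer_mono[of A UNIV] content_outer_UNIV by simp

lemma outer_measure_space_content: "outer_measure_space (Pow UNIV) (content_outer m)"
  unfolding outer_measure_space_def
proof (intro conjI)
  show "positive (Pow UNIV) (content_outer m)"
    by (simp add: positive_def content_outer_open inner_content_empty)
  show "increasing (Pow UNIV) (content_outer m)"
    by (simp add: increasing_def content_outer_mono)
  show "countably_subadditive (Pow UNIV) (content_outer m)"
    unfolding countably_subadditive_def
  proof (intro allI impI)
    fix A :: "nat \<Rightarrow> 'a set"
    show "content_outer m (\<Union>i. A i) \<le> (\<Sum>i. content_outer m (A i))"
    proof (rule ennreal_le_epsilon)
      fix e :: real assume e: "0 < e"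
      have "\<exists>U. open U \<and> A i \<subseteq> U \<and> inner_content m U \<le> content_outer m (A i) + ennreal (e * (1 / 2) ^ Suc i)" for i
      proof -
        have "content_outer m (A i) < content_outer m (A i) + ennreal (e * (1 / 2) ^ Suc i)"
          using content_outer_le_one[of "A i"] e ennreal_add_left_cancel_less[of "content_outer m (A i)" 0]
          by (auto simp: top_unique)
        then show ?thesis
          unfolding content_outer_def[of m "A i"] INF_less_iff
          by (metis (no_types, lifting) content_outer_def less_imp_le mem_Collect_eq)
      qed
      then obtain U where U: "\<And>i. open (U i)" "\<And>i. A i \<subseteq> U i"
        "\<And>i. inner_content m (U i) \<le> content_outer m (A i) + ennreal (e * (1 / 2) ^ Suc i)" by metis
      have "content_outer m (\<Union>i. A i) \<le> content_outer m (\<Union>i. U i)"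
        using U(2) by (intro content_outer_mono) blast
      also have "\<dots> = inner_content m (\<Union>i. U i)" using U(1) by (intro content_outer_open) blast
      also have "\<dots> \<le> (\<Sum>i. inner_content m (U i))" by (rule inner_content_UN[OF U(1)])
      also have "\<dots> \<le> (\<Sum>i. content_outer m (A i) + ennreal (e * (1 / 2) ^ Suc i))"
        by (intro suminf_le U(3)) auto
      also have "\<dots> = (\<Sum>i. content_outer m (A i)) + (\<Sum>i. ennreal e * ennreal ((1 / 2) ^ Suc i))"
        using e by (subst suminf_add[symmetric]) (auto simp del: ennreal_suminf_cmult simp flip: ennreal_mult)
      also have "(\<Sum>i. ennreal e * ennreal ((1 / 2) ^ Suc i)) = ennreal e"
        unfolding ennreal_suminf_cmult
        by (subst suminf_ennreal_eq[OF zero_le_power power_half_series]) auto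
      finally show "content_outer m (\<Union>i. A i) \<le> (\<Sum>i. content_outer m (A i)) + ennreal e" .
    qed
  qed
qed

text \<open>For open \<open>W\<close> containing \<open>A\<close>, exhaust
  \<open>W \<inter> G\<close> by closed sets \<open>K\<close> and then \<open>W - K\<close> by
  closed sets \<open>L\<close>. The two are disjoint, \<open>m\<close> is additive on them, and
  \<open>W - K\<close> contains \<open>W - G\<close>.\<close>

lemma open_in_lambda_system:
  assumes G: "open G"
  shows "G \<in> lambda_system UNIV (Pow UNIV) (content_outer m)"
proof -
  have le: "content_outer m (A \<inter> G) + content_outer m (A - G) \<le> content_outer m A" for A
    unfolding content_outer_def[of m A]
  proof (rule INF_greatest)
    fix W assume "W \<in> {U. open U \<and> A \<subseteq> U}"
    then have W: "open W" "A \<subseteq> W" by auto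
    have *: "ennreal (m K) + content_outer m (W - G) \<le> inner_content m W"
      if K: "closed K" "K \<subseteq> W \<inter> G" for K
    proof -
      have "ennreal (m K) + inner_content m (W - K) \<le> inner_content m W"
        unfolding inner_content_def[of m "W - K"]
      proof (subst ennreal_SUP_add_right)
        show "{L. closed L \<and> L \<subseteq> W - K} \<noteq> {}" by auto
        show "(SUP L\<in>{L. closed L \<and> L \<subseteq> W - K}. ennreal (m K) + ennreal (m L)) \<le> inner_content m W"
        proof (rule SUP_least)
          fix L assume "L \<in> {L. closed L \<and> L \<subseteq> W - K}"
          then have L: "closed L" "L \<subseteq> W - K" and "K \<inter> L = {}" by auto
          have "ennreal (m K) + ennreal (m L) = ennreal (m (K \<union> L))"
            using additive[OF \<open>K \<inter> L = {}\<close>] by (subst ennreal_plus[symmetric]) (auto simp: nonneg)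
          also have "\<dots> \<le> inner_content m W" using K L by (intro inner_content_ge) auto
          finally show "ennreal (m K) + ennreal (m L) \<le> inner_content m W" .
        qed
      qed
      moreover have "content_outer m (W - G) \<le> inner_content m (W - K)"
        using K W content_outer_mono[of "W - G" "W - K"] content_outer_open[of "W - K"]
        by (auto simp: open_Diff)
      ultimately show ?thesis by (meson add_left_mono order_trans)
    qed
    have "content_outer m (A \<inter> G) + content_outer m (A - G) \<le> content_outer m (W \<inter> G) + content_outer m (W - G)"
      using W by (intro add_mono content_outer_mono) blast+
    also have "content_outer m (W \<inter> G) = inner_content m (W \<inter> G)"
      using W G by (intro content_outer_open) blast
    also have "inner_content m (W \<inter> G) + content_outer m (W - G) = (SUP K\<in>{K. closed K \<and> K \<subseteq> W \<inter> G}. ennreal (m K) + content_outer m (W - G))"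
      unfolding inner_content_def by (rule ennreal_SUP_add_left[symmetric]) auto
    also have "\<dots> \<le> inner_content m W" using * by (intro SUP_least) auto
    finally show "content_outer m (A \<inter> G) + content_outer m (A - G) \<le> inner_content m W" .
  qed
  have ge: "content_outer m A \<le> content_outer m (A \<inter> G) + content_outer m (A - G)" for A
  proof -
    interpret sigma_algebra "UNIV :: 'a set" "Pow UNIV" by (rule sigma_algebra_Pow)
    have "subadditive (Pow UNIV) (content_outer m)"
      using outer_measure_space_content unfolding outer_measure_space_def
      by (intro countably_subadditive_subadditive) blast+
    then have "content_outer m ((A \<inter> G) \<union> (A - G)) \<le> content_outer m (A \<inter> G) + content_outer m (A - G)"
      by (rule subadditiveD) auto
    moreover have "(A \<inter> G) \<union> (A - G) = A" by blast
    ultimately show ?thesis by simp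
  qed
  have "content_outer m (G \<inter> A) + content_outer m ((UNIV - G) \<inter> A) = content_outer m A" for A
  proof -
    have *: "G \<inter> A = A \<inter> G" "(UNIV - G) \<inter> A = A - G" by auto
    show ?thesis unfolding * by (rule antisym[OF le ge])
  qed
  then show ?thesis by (simp add: lambda_system_def)
qed

lemma extension_to_borel:
  "\<exists>\<mu>. prob_space \<mu> \<and> sets \<mu> = sets borel \<and> (\<forall>A\<in>sets borel. emeasure \<mu> A = content_outer m A)"
proof -
  interpret sigma_algebra "UNIV :: 'a set" "Pow UNIV" by (rule sigma_algebra_Pow)
  let ?L = "lambda_system UNIV (Pow UNIV) (content_outer m)"
  have ms: "measure_space UNIV ?L (content_outer m)"
    by (rule caratheodory_lemma[OF outer_measure_space_content])
  then interpret L: sigma_algebra UNIV ?L by (simp add: measure_space_def)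
  have sub: "sets borel \<subseteq> ?L"
    unfolding sets_borel using open_in_lambda_system by (intro L.sigma_sets_subset) auto
  define \<mu> where "\<mu> = measure_of UNIV (sets (borel :: 'a measure)) (content_outer m)"
  have sets: "sets \<mu> = sets borel"
    unfolding \<mu>_def using sets.sigma_sets_eq[of "borel :: 'a measure"] by (simp add: sets_measure_of)
  have em: "emeasure \<mu> A = content_outer m A" if "A \<in> sets borel" for A
  proof (rule emeasure_measure_of[OF \<mu>_def])
    show "sets borel \<subseteq> Pow (UNIV :: 'a set)" by simp
    show "A \<in> sets \<mu>" using that sets by simp
    show "positive (sets \<mu>) (content_outer m)"
      by (simp add: positive_def content_outer_open inner_content_empty)
    have "countably_additive ?L (content_outer m)" using ms by (simp add: measure_space_def)
    then show "countably_additive (sets \<mu>) (content_outer m)"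
      using sub unfolding countably_additive_def sets by blast
  qed
  have "space \<mu> = UNIV" using sets_eq_imp_space_eq[OF sets] by simp
  then have "prob_space \<mu>" using em[of UNIV] content_outer_UNIV by (intro prob_spaceI) simp
  then show ?thesis using sets em by blast
qed

text \<open>A homeomorphism permutes the closed sets and the open sets, so the regularisation
  inherits invariance.\<close>

lemma content_outer_vimage:
  assumes T: "homeomorphic_map euclidean euclidean T" and inv: "\<And>A. m (T -` A) = m A"
  shows "content_outer m (T -` A) = content_outer m A"
proof -
  have cont: "continuous_on UNIV T" and bij: "bij T"
    and open_img: "\<And>U. open U \<Longrightarrow> open (T ` U)" and closed_img: "\<And>U. closed U \<Longrightarrow> closed (T ` U)"
    using T homeomorphic_imp_open_map[OF T] homeomorphic_imp_closed_map[OF T]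
      homeomorphic_imp_continuous_map[OF T] homeomorphic_imp_injective_map[OF T] homeomorphic_imp_surjective_map[OF T]
    by (auto simp: open_map_def closed_map_def bij_def)
  have vo: "open (T -` U)" if "open U" for U using cont that by (simp add: open_vimage continuous_on_eq_continuous_at)
  have vc: "closed (T -` U)" if "closed U" for U using cont that by (simp add: closed_vimage continuous_on_eq_continuous_at)
  have vi: "T -` (T ` U) = U" and iv: "T ` (T -` U) = U" for U
    using bij by (auto simp: inj_vimage_image_eq bij_def surj_image_vimage_eq)
  have img: "m (T ` A) = m A" for A using inv[of "T ` A"] vi by simp
  have le1: "inner_content m (T -` U) \<le> inner_content m U" for U
    unfolding inner_content_def[of m "T -` U"]
  proof (rule SUP_least)
    fix K assume "K \<in> {K. closed K \<and> K \<subseteq> T -` U}"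
    then show "ennreal (m K) \<le> inner_content m U"
      using inner_content_ge[of "T ` K" U] closed_img[of K] img[of K] by auto
  qed
  have le2: "inner_content m (T ` U) \<le> inner_content m U" for U
    unfolding inner_content_def[of m "T ` U"]
  proof (rule SUP_least)
    fix K assume "K \<in> {K. closed K \<and> K \<subseteq> T ` U}"
    then have "closed K" "T -` K \<subseteq> T -` (T ` U)" by blast+
    then have K: "closed (T -` K)" "T -` K \<subseteq> U" using vc vi by simp_all
    show "ennreal (m K) \<le> inner_content m U"
      using inner_content_ge[OF K] inv[of K] by simp
  qed
  show ?thesis
  proof (rule antisym)
    show "content_outer m (T -` A) \<le> content_outer m A"
      unfolding content_outer_def[of m A]
    proof (rule INF_greatest)
      fix U assume "U \<in> {U. open U \<and> A \<subseteq> U}"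
      then have "content_outer m (T -` A) \<le> inner_content m (T -` U)"
        using vo unfolding content_outer_def by (intro INF_lower) auto
      then show "content_outer m (T -` A) \<le> inner_content m U" using le1 by (rule order_trans)
    qed
    show "content_outer m A \<le> content_outer m (T -` A)"
      unfolding content_outer_def[of m "T -` A"]
    proof (rule INF_greatest)
      fix U assume U: "U \<in> {U. open U \<and> T -` A \<subseteq> U}"
      then have "A \<subseteq> T ` U" using iv[of A] by blast
      then have "content_outer m A \<le> inner_content m (T ` U)"
        using U open_img unfolding content_outer_def by (intro INF_lower) auto
      then show "content_outer m A \<le> inner_content m U" using le2 by (rule order_trans)
    qed
  qed
qed

end

text \<open>The cube of all functions into \<open>{0..1}\<close> is compact by Tychonoff. As
  \<open>'b\<close> will be the type of all subsets of the space, a cluster point is taken instead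
  of a convergent subsequence; it is approximated on finitely many arguments at a time.\<close>

lemma cluster_set_function:
  fixes f :: "nat \<Rightarrow> 'b \<Rightarrow> real"
  assumes "\<And>N A. f N A \<in> {0..1}"
  shows "\<exists>m. \<forall>S e N0. finite S \<longrightarrow> e > 0 \<longrightarrow> (\<exists>N\<ge>N0. \<forall>A\<in>S. \<bar>f N A - m A\<bar> < e)"
proof -
  have "compactin (product_topology (\<lambda>_. euclideanreal) UNIV) (PiE UNIV (\<lambda>_ :: 'b. {0..1}))"
    by (subst compactin_PiE) auto
  then have comp: "compact (PiE UNIV (\<lambda>_ :: 'b. {0..1 :: real}))"
    by (simp add: euclidean_product_topology)
  have "eventually (\<lambda>x. x \<in> PiE UNIV (\<lambda>_. {0..1})) (filtermap f sequentially)"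
    using assms by (auto simp: eventually_filtermap PiE_iff)
  then obtain m where m: "inf (nhds m) (filtermap f sequentially) \<noteq> bot"
    using comp[unfolded compact_filter] by (metis filtermap_bot_iff trivial_limit_sequentially)
  have "\<exists>N\<ge>N0. \<forall>A\<in>S. \<bar>f N A - m A\<bar> < e" if S: "finite S" and e: "e > 0" for S e N0
  proof (rule ccontr)
    assume no: "\<not> ?thesis"
    have "eventually (\<lambda>x. \<forall>A\<in>S. \<bar>x A - m A\<bar> < e) (nhds m)"
    proof (rule eventually_ball_finite[OF S], rule ballI)
      fix A
      have "open {x. \<bar>x A - m A\<bar> < e}"
        by (intro open_Collect_less continuous_intros continuous_on_product_coordinates)
      then show "eventually (\<lambda>x. \<bar>x A - m A\<bar> < e) (nhds m)"
        using e eventually_nhds_in_open[of "{x. \<bar>x A - m A\<bar> < e}" m] by simp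
    qed
    moreover have "eventually (\<lambda>x. \<exists>N\<ge>N0. x = f N) (filtermap f sequentially)"
      unfolding eventually_filtermap eventually_sequentially by blast
    ultimately have "eventually (\<lambda>x. False) (inf (nhds m) (filtermap f sequentially))"
      unfolding eventually_inf using no by blast
    then show False using m by (simp add: trivial_limit_def)
  qed
  then show ?thesis by blast
qed

text \<open>Were every \<open>N\<close> to fail, orbit segments with average count above
  \<open>D\<close> would yield an invariant measure giving the \<open>F i\<close> total mass at
  least \<open>D\<close>, against the strict bound.\<close>

lemma uniform_orbit_average:
  fixes T :: "'a::metric_space \<Rightarrow> 'a"
  assumes comp: "compact (UNIV :: 'a set)" and T: "homeomorphic_map euclidean euclidean T"
    and I: "finite I" and F: "\<And>i. i \<in> I \<Longrightarrow> closed (F i)"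
    and bound: "\<And>\<mu>. \<mu> \<in> invariant_measures T \<Longrightarrow> (\<Sum>i\<in>I. measure \<mu> (F i)) < real D"
  shows "\<exists>N\<ge>1. \<forall>x. (\<Sum>k<N. card {i\<in>I. (T ^^ k) x \<in> F i}) \<le> D * N"
proof (rule ccontr)
  assume no: "\<not> ?thesis"
  have "\<exists>x. D * Suc N < (\<Sum>k<Suc N. card {i\<in>I. (T ^^ k) x \<in> F i})" for N
  proof (rule ccontr)
    assume "\<not> ?thesis"
    then have "\<forall>x. (\<Sum>k<Suc N. card {i\<in>I. (T ^^ k) x \<in> F i}) \<le> D * Suc N"
      by (simp add: not_less del: sum.lessThan_Suc)
    moreover have "1 \<le> Suc N" by simp
    ultimately show False using no by blast
  qed
  then have "\<forall>N. \<exists>x. D * Suc N < (\<Sum>k<Suc N. card {i\<in>I. (T ^^ k) x \<in> F i})" by blast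
  then obtain x where x: "\<forall>N. D * Suc N < (\<Sum>k<Suc N. card {i\<in>I. (T ^^ k) (x N) \<in> F i})"
    by (rule choice[THEN exE])
  \<comment> \<open>The empirical measure of the orbit segment of length \<open>Suc N\<close> from
    \<open>x N\<close>, evaluated on every subset.\<close>
  define f where "f N A = (\<Sum>k<Suc N. indicator A ((T ^^ k) (x N)) :: real) / Suc N" for N A
  have f01: "f N A \<in> {0..1}" for N A
  proof -
    have "(\<Sum>k<Suc N. indicator A ((T ^^ k) (x N)) :: real) \<le> (\<Sum>k<Suc N. 1)"
      by (intro sum_mono indicator_le_1)
    then show ?thesis by (simp add: f_def sum_nonneg divide_le_eq del: sum.lessThan_Suc)
  qed
  have fU: "f N UNIV = 1" for N by (simp add: f_def del: sum.lessThan_Suc)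
  have fadd: "f N (A \<union> B) = f N A + f N B" if "A \<inter> B = {}" for N A B
    using that by (simp add: f_def indicator_add[symmetric] sum.distrib add_divide_distrib del: sum.lessThan_Suc)
  \<comment> \<open>The difference telescopes to the two ends of the segment.\<close>
  have finv: "\<bar>f N (T -` A) - f N A\<bar> \<le> 1 / Suc N" for N A
  proof -
    have "(\<Sum>k<Suc N. indicator (T -` A) ((T ^^ k) (x N)) :: real) - (\<Sum>k<Suc N. indicator A ((T ^^ k) (x N)))
        = (\<Sum>k<Suc N. indicator A ((T ^^ Suc k) (x N)) - indicator A ((T ^^ k) (x N)))"
      by (simp add: sum_subtractf indicator_vimage[unfolded comp_def, symmetric] indicator_def del: sum.lessThan_Suc)
    also have "\<dots> = indicator A ((T ^^ Suc N) (x N)) - indicator A (x N)"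
      by (subst sum_lessThan_telescope) simp
    finally have "f N (T -` A) - f N A = (indicator A ((T ^^ Suc N) (x N)) - indicator A (x N)) / Suc N"
      unfolding f_def diff_divide_distrib[symmetric] by simp
    then show ?thesis by (simp add: indicator_def divide_right_mono)
  qed
  have fsum: "real D \<le> (\<Sum>i\<in>I. f N (F i))" for N
  proof -
    have ind: "card {i\<in>I. y \<in> F i} = (\<Sum>i\<in>I. indicator (F i) y :: real)" for y
      using I by (simp add: indicator_def sum.If_cases Int_def)
    have "real (D * Suc N) < real (\<Sum>k<Suc N. card {i\<in>I. (T ^^ k) (x N) \<in> F i})"
      using x by (simp only: of_nat_less_iff)
    also have "real (\<Sum>k<Suc N. card {i\<in>I. (T ^^ k) (x N) \<in> F i}) = (\<Sum>i\<in>I. \<Sum>k<Suc N. indicator (F i) ((T ^^ k) (x N)))"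
      by (subst sum.swap) (simp add: ind del: sum.lessThan_Suc)
    also have "\<dots> = Suc N * (\<Sum>i\<in>I. f N (F i))"
      by (simp add: f_def sum_divide_distrib[symmetric] del: sum.lessThan_Suc)
    finally have "real (Suc N) * real D < real (Suc N) * (\<Sum>i\<in>I. f N (F i))" by (simp only: of_nat_mult mult.commute)
    then show ?thesis
      by (simp only: mult_less_cancel_left_pos of_nat_0_less_iff zero_less_Suc less_imp_le)
  qed
  obtain m where m: "\<And>S e N0. finite S \<Longrightarrow> e > 0 \<Longrightarrow> \<exists>N\<ge>N0. \<forall>A\<in>S. \<bar>f N A - m A\<bar> < e"
    using cluster_set_function[of f, OF f01] by metis
  interpret finitely_additive_prob m
  proof
    show "compact (UNIV :: 'a set)" by (rule comp)
    show "m A \<ge> 0" for A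
    proof (rule field_le_epsilon)
      fix e :: real assume "e > 0"
      then obtain N where "\<bar>f N A - m A\<bar> < e" using m[of "{A}" e 0] by auto
      then show "0 \<le> m A + e" using f01[of N A] by auto
    qed
    show "m UNIV = 1"
    proof (rule ccontr)
      assume "m UNIV \<noteq> 1"
      then obtain N where "\<bar>f N UNIV - m UNIV\<bar> < \<bar>1 - m UNIV\<bar>" using m[of "{UNIV}" "\<bar>1 - m UNIV\<bar>" 0] by auto
      then show False by (simp add: fU)
    qed
    fix A B :: "'a set" assume AB: "A \<inter> B = {}"
    show "m (A \<union> B) = m A + m B"
    proof (rule ccontr)
      assume "m (A \<union> B) \<noteq> m A + m B"
      then obtain N where "\<forall>C\<in>{A, B, A \<union> B}. \<bar>f N C - m C\<bar> < \<bar>m (A \<union> B) - (m A + m B)\<bar> / 3"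
        using m[of "{A, B, A \<union> B}" "\<bar>m (A \<union> B) - (m A + m B)\<bar> / 3" 0] by auto
      then have "\<bar>f N A - m A\<bar> < \<bar>m (A \<union> B) - (m A + m B)\<bar> / 3"
        "\<bar>f N B - m B\<bar> < \<bar>m (A \<union> B) - (m A + m B)\<bar> / 3"
        "\<bar>f N A + f N B - m (A \<union> B)\<bar> < \<bar>m (A \<union> B) - (m A + m B)\<bar> / 3"
        using fadd[OF AB, of N] by auto
      then show False by argo
    qed
  qed
  have inv: "m (T -` A) = m A" for A
  proof (rule ccontr)
    assume ne: "m (T -` A) \<noteq> m A"
    define e where "e = \<bar>m (T -` A) - m A\<bar> / 3"
    have e: "e > 0" using ne by (simp add: e_def)
    obtain N0 :: nat where N0: "1 / Suc N0 < e" using e reals_Archimedean[of e] by (auto simp: inverse_eq_divide)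
    obtain N where N: "N \<ge> N0" "\<forall>C\<in>{A, T -` A}. \<bar>f N C - m C\<bar> < e" using m[of "{A, T -` A}" e N0] e by auto
    have "1 / Suc N \<le> 1 / Suc N0" using N by (intro divide_left_mono) auto
    then have "\<bar>f N (T -` A) - f N A\<bar> < e" using finv[of N A] N0 by linarith
    moreover have "\<bar>f N A - m A\<bar> < e" "\<bar>f N (T -` A) - m (T -` A)\<bar> < e" using N by auto
    ultimately show False unfolding e_def by argo
  qed
  have msum: "real D \<le> (\<Sum>i\<in>I. m (F i))"
  proof (rule field_le_epsilon)
    fix e :: real assume e: "e > 0"
    define e' where "e' = e / (card I + 1)"
    have e': "e' > 0" using e by (simp add: e'_def)
    obtain N where N: "\<forall>C\<in>F ` I. \<bar>f N C - m C\<bar> < e'" using m[of "F ` I" e' 0] I e' by auto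
    have "real D \<le> (\<Sum>i\<in>I. f N (F i))" by (rule fsum)
    also have "\<dots> \<le> (\<Sum>i\<in>I. m (F i) + e')" using N by (intro sum_mono) (force simp: abs_less_iff)
    also have "\<dots> = (\<Sum>i\<in>I. m (F i)) + card I * e'" by (simp add: sum.distrib)
    also have "card I * e' \<le> e" using e by (simp add: e'_def field_simps)
    finally show "real D \<le> (\<Sum>i\<in>I. m (F i)) + e" by simp
  qed
  obtain \<mu> where \<mu>: "prob_space \<mu>" "sets \<mu> = sets borel" "\<And>A. A \<in> sets borel \<Longrightarrow> emeasure \<mu> A = content_outer m A"
    using extension_to_borel by blast
  have "T \<in> borel_measurable borel"
    using homeomorphic_imp_continuous_map[OF T] by (intro borel_measurable_continuous_onI) simp
  then have "T -` A \<in> sets borel" if "A \<in> sets borel" for A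
    using that measurable_sets[of T borel borel A] by simp
  then have "\<mu> \<in> invariant_measures T"
    unfolding invariant_measures_def using \<mu> content_outer_vimage[OF T inv] by simp
  then have "(\<Sum>i\<in>I. measure \<mu> (F i)) < real D" by (rule bound)
  moreover have "m (F i) \<le> measure \<mu> (F i)" if "i \<in> I" for i
  proof -
    interpret prob_space \<mu> by fact
    have "ennreal (m (F i)) \<le> emeasure \<mu> (F i)"
      using content_outer_closed[OF F[OF that]] \<mu>(3)[of "F i"] F[OF that] by simp
    then show ?thesis by (simp add: emeasure_eq_measure)
  qed
  then have "(\<Sum>i\<in>I. m (F i)) \<le> (\<Sum>i\<in>I. measure \<mu> (F i))" by (rule sum_mono)
  ultimately show False using msum by linarith
qed

section \<open>Separating perturbations\<close>

text \<open>From an ordinary partition of unity half the average value, \<open>1 / (2 * m)\<close>,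
  is cut off. Some function exceeds this threshold at each point, so the sum stays positive and can
  be normalised; the new supports lie in the closed sets where the old functions reach the
  threshold.\<close>

lemma closed_partition_of_unity:
  fixes \<V> :: "'a::metric_space set set"
  assumes fin: "finite \<V>" and op: "\<And>V. V \<in> \<V> \<Longrightarrow> open V" and cov: "\<Union>\<V> = UNIV"
  shows "\<exists>\<phi> F. (\<forall>V. continuous_on UNIV (\<phi> V)) \<and> (\<forall>V x. 0 \<le> \<phi> V x) \<and> (\<forall>V x. V \<notin> \<V> \<longrightarrow> \<phi> V x = (0::real))
    \<and> (\<forall>x. (\<Sum>V\<in>\<V>. \<phi> V x) = 1) \<and> (\<forall>V\<in>\<V>. closed (F V) \<and> F V \<subseteq> V \<and> (\<forall>x. \<phi> V x \<noteq> 0 \<longrightarrow> x \<in> F V))"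
proof -
  have loc: "\<exists>W. open W \<and> x \<in> W \<and> finite {U \<in> \<V>. U \<inter> W \<noteq> {}}" if "x \<in> UNIV" for x
    using fin by (intro exI[of _ UNIV]) auto
  have "\<exists>\<psi>. (\<forall>V\<in>\<V>. continuous_on UNIV (\<psi> V) \<and> (\<forall>x. 0 \<le> \<psi> V x) \<and> (\<forall>x. x \<notin> V \<longrightarrow> \<psi> V x = 0))
      \<and> (\<forall>x. supp_sum (\<lambda>V. \<psi> V x) \<V> = (1::real))"
  proof (rule subordinate_partition_of_unity[of "UNIV :: 'a set" \<V>, OF eq_refl[OF cov[symmetric]] op loc])
    fix \<psi> :: "'a set \<Rightarrow> 'a \<Rightarrow> real"
    assume "\<And>V. V \<in> \<V> \<Longrightarrow> continuous_on UNIV (\<psi> V) \<and> (\<forall>x\<in>UNIV. 0 \<le> \<psi> V x)"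
      "\<And>x V. V \<in> \<V> \<Longrightarrow> x \<in> UNIV \<Longrightarrow> x \<notin> V \<Longrightarrow> \<psi> V x = 0"
      "\<And>x. x \<in> UNIV \<Longrightarrow> supp_sum (\<lambda>V. \<psi> V x) \<V> = 1"
    then show ?thesis by (intro exI[of _ \<psi>]) simp
  qed
  then obtain \<psi> :: "'a set \<Rightarrow> 'a \<Rightarrow> real" where \<psi>: "\<And>V. V \<in> \<V> \<Longrightarrow> continuous_on UNIV (\<psi> V)"
    "\<And>x V. V \<in> \<V> \<Longrightarrow> x \<notin> V \<Longrightarrow> \<psi> V x = 0" "\<And>x. supp_sum (\<lambda>V. \<psi> V x) \<V> = 1"
    by blast
  have one: "(\<Sum>V\<in>\<V>. \<psi> V x) = 1" for x
  proof -
    have "(\<Sum>V\<in>\<V>. \<psi> V x) = (\<Sum>V\<in>support_on \<V> (\<lambda>V. \<psi> V x). \<psi> V x)"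
      using fin by (intro sum.mono_neutral_right) (auto simp: support_on_def)
    then show ?thesis using \<psi>(3)[of x] by (simp add: supp_sum_def)
  qed
  define m where "m = real (card \<V>)"
  have "\<V> \<noteq> {}" using cov by auto
  then have m: "m > 0" using fin by (simp add: m_def card_gt_0_iff)
  define h where "h V x = max 0 (\<psi> V x - 1 / (2 * m))" for V x
  have hc: "continuous_on UNIV (h V)" if "V \<in> \<V>" for V
    unfolding h_def using \<psi>(1)[OF that] by (intro continuous_intros) auto
  have hs: "(\<Sum>V\<in>\<V>. h V x) > 0" for x
  proof -
    have "\<exists>V\<in>\<V>. \<psi> V x > 1 / (2 * m)"
    proof (rule ccontr)
      assume "\<not> ?thesis"
      then have "(\<Sum>V\<in>\<V>. \<psi> V x) \<le> real (card \<V>) * (1 / (2 * m))"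
        by (intro sum_bounded_above) (auto simp: not_less)
      also have "\<dots> < 1" using m by (simp add: m_def)
      finally show False using one by simp
    qed
    then obtain V where "V \<in> \<V>" "h V x > 0" by (auto simp: h_def)
    then show ?thesis using fin by (intro sum_pos2) (auto simp: h_def)
  qed
  define \<phi> where "\<phi> V x = (if V \<in> \<V> then h V x / (\<Sum>W\<in>\<V>. h W x) else 0)" for V x
  define F where "F V = {x. 1 / (2 * m) \<le> \<psi> V x}" for V
  have "continuous_on UNIV (\<phi> V)" for V
  proof (cases "V \<in> \<V>")
    case True
    have "continuous_on UNIV (\<lambda>x. h V x / (\<Sum>W\<in>\<V>. h W x))"
      using hc True hs by (intro continuous_intros) (auto simp: less_le)
    then show ?thesis using True unfolding \<phi>_def by simp
  qed (simp add: \<phi>_def)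
  moreover have "0 \<le> \<phi> V x" for V x
    unfolding \<phi>_def using hs[of x] by (auto simp: h_def intro!: divide_nonneg_pos)
  moreover have "(\<Sum>V\<in>\<V>. \<phi> V x) = 1" for x
    using hs[of x] by (simp add: \<phi>_def sum_divide_distrib[symmetric])
  moreover have "closed (F V)" "F V \<subseteq> V" "\<And>x. \<phi> V x \<noteq> 0 \<Longrightarrow> x \<in> F V" if V: "V \<in> \<V>" for V
  proof -
    show "closed (F V)" unfolding F_def using \<psi>(1)[OF V] by (intro closed_Collect_le) auto
    show "F V \<subseteq> V"
    proof
      fix x assume "x \<in> F V"
      then have "\<psi> V x \<noteq> 0" using m by (auto simp: F_def)
      then show "x \<in> V" using \<psi>(2)[OF V] by auto
    qed
    show "x \<in> F V" if "\<phi> V x \<noteq> 0" for x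
      using that V by (auto simp: \<phi>_def h_def F_def max_def split: if_splits)
  qed
  ultimately show ?thesis by (intro exI[of _ \<phi>] exI[of _ F]) (auto simp: \<phi>_def)
qed

section \<open>Approximation by generic polynomials on fine covers\<close>

lemma fine_cover_ex:
  fixes f :: "'a::metric_space \<Rightarrow> nat \<Rightarrow> real"
  assumes comp: "compact (UNIV :: 'a set)" and f: "\<And>c. c < n \<Longrightarrow> continuous_on UNIV (\<lambda>x. f x c)"
    and e: "e > 0" and d: "d > 0"
  shows "\<exists>\<U>\<in>finite_open_covers. \<forall>U\<in>\<U>. \<forall>x\<in>U. \<forall>y\<in>U. dist x y < e \<and> (\<forall>c<n. \<bar>f x c - f y c\<bar> \<le> d)"
proof -
  define nb where "nb x = ball x (e / 2) \<inter> (\<Inter>c\<in>{..<n}. {y. \<bar>f x c - f y c\<bar> < d / 2})" for x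
  have op: "open (nb x)" for x
    unfolding nb_def using f
    by (intro open_Int open_ball open_INT ballI open_Collect_less continuous_intros) auto
  have mem: "x \<in> nb x" for x using e d by (auto simp: nb_def)
  obtain C where C: "finite C" "UNIV \<subseteq> (\<Union>x\<in>C. nb x)"
    using compactE_image[of UNIV UNIV nb] comp op mem by (metis UNIV_I UN_I subsetI)
  have "dist y z < e \<and> (\<forall>c<n. \<bar>f y c - f z c\<bar> \<le> d)" if yz: "y \<in> nb x" "z \<in> nb x" for x y z
  proof (intro conjI allI impI)
    show "dist y z < e" using yz dist_triangle_half_r[of x y e z] by (auto simp: nb_def)
    fix c assume "c < n"
    then have "\<bar>f x c - f y c\<bar> < d / 2" "\<bar>f x c - f z c\<bar> < d / 2" using yz by (auto simp: nb_def)
    then show "\<bar>f y c - f z c\<bar> \<le> d" by linarith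
  qed
  then show ?thesis
    using C op by (intro bexI[of _ "nb ` C"]) (auto simp: finite_open_covers_def)
qed

lemma abs_feature_le_one:
  assumes "\<And>d. \<bar>z d\<bar> \<le> 1"
  shows "\<bar>feature s z e\<bar> \<le> 1"
proof -
  have "\<bar>feature s z e\<bar> = (\<Prod>j<s. \<bar>case e j of None \<Rightarrow> 1 | Some d \<Rightarrow> z d\<bar>)"
    by (simp add: feature_def abs_prod)
  also have "\<dots> \<le> (\<Prod>j<s. 1)"
    using assms by (intro prod_mono) (auto split: option.split)
  finally show ?thesis by simp
qed

text \<open>The linear map to be approximated is a combination of features, with coefficients
  \<open>W0\<close>. Moving these by less than \<open>\<eta>\<close> to generic ones costs at most
  \<open>\<eta>\<close> per feature on points with coordinates bounded by 1.\<close>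

lemma generic_map_near_ex:
  fixes a :: "'v \<Rightarrow> nat \<Rightarrow> real" and L :: nat
  assumes V: "finite V" and L: "L \<ge> 1" and s: "s \<ge> 1" and d: "d > 0"
  shows "\<exists>G. generic_map n s ({..<L} \<times> V) G \<and> (\<forall>c. continuous_on UNIV (\<lambda>z. G z c))
    \<and> (\<forall>z. \<forall>c<n. (\<forall>i. \<bar>z i\<bar> \<le> 1) \<longrightarrow> \<bar>G z c - (\<Sum>v\<in>V. a v c * z (0, v))\<bar> \<le> d)"
proof -
  define I where "I = {..<L} \<times> V"
  have I: "finite I" using V by (simp add: I_def)
  \<comment> \<open>One factor of the monomial is \<open>z (0, v)\<close>, the others are 1.\<close>
  define ev where "ev v = restrict (\<lambda>j::nat. if j = 0 then Some (0::nat, v) else None) {..<s}" for v :: 'v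
  have ev: "ev v \<in> features s I" if "v \<in> V" for v
    using that L by (auto simp: ev_def features_def I_def)
  have inj: "inj_on ev V"
  proof (rule inj_onI)
    fix v w assume "ev v = ev w"
    then have "ev v 0 = ev w 0" by simp
    then show "v = w" using s by (simp add: ev_def)
  qed
  have fev: "feature s z (ev v) = z (0, v)" for z v
  proof -
    have "feature s z (ev v) = (\<Prod>j<s. if j = 0 then z (0, v) else 1)"
      unfolding feature_def by (rule prod.cong) (auto simp: ev_def)
    also have "\<dots> = z (0, v)" using s by (simp add: prod.delta)
    finally show ?thesis .
  qed
  define W0 where "W0 e c = (if e \<in> ev ` V then a (the_inv_into V ev e) c else 0)" for e c
  define \<eta> where "\<eta> = d / (card (features s I) + 1)"
  have \<eta>: "\<eta> > 0" using d by (simp add: \<eta>_def)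
  obtain W where W: "\<And>e c. e \<in> features s I \<Longrightarrow> c < n \<Longrightarrow> \<bar>W e c - W0 e c\<bar> < \<eta>"
    and gen: "generic_map n s I (\<lambda>z c. \<Sum>e\<in>features s I. W e c * feature s z e)"
    using generic_coefficients_ex[OF I \<eta>, of s n W0] by blast
  have "continuous_on UNIV (\<lambda>z. \<Sum>e\<in>features s I. W e c * feature s z e)" for c
  proof -
    have "continuous_on UNIV (\<lambda>z. (case x of None \<Rightarrow> 1 | Some i \<Rightarrow> z i) :: real)" for x :: "(nat \<times> 'v) option"
      by (cases x) (auto intro: continuous_on_const continuous_on_product_coordinates)
    then show ?thesis unfolding feature_def
      by (intro continuous_on_sum continuous_on_mult continuous_on_const continuous_on_prod)
  qed
  moreover have "\<bar>(\<Sum>e\<in>features s I. W e c * feature s z e) - (\<Sum>v\<in>V. a v c * z (0, v))\<bar> \<le> d"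
    if c: "c < n" and z: "\<forall>i. \<bar>z i\<bar> \<le> 1" for z :: "nat \<times> 'v \<Rightarrow> real" and c
  proof -
    have "(\<Sum>e\<in>features s I. W0 e c * feature s z e) = (\<Sum>e\<in>ev ` V. W0 e c * feature s z e)"
      using ev finite_features[OF I] by (intro sum.mono_neutral_right) (auto simp: W0_def)
    also have "\<dots> = (\<Sum>v\<in>V. a v c * z (0, v))"
      by (simp add: sum.reindex[OF inj] W0_def the_inv_into_f_f[OF inj] fev)
    finally have "(\<Sum>e\<in>features s I. W e c * feature s z e) - (\<Sum>v\<in>V. a v c * z (0, v))
        = (\<Sum>e\<in>features s I. (W e c - W0 e c) * feature s z e)"
      by (simp add: left_diff_distrib sum_subtractf)
    also have "\<bar>\<dots>\<bar> \<le> (\<Sum>e\<in>features s I. \<eta> * 1)"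
    proof (rule order_trans[OF sum_abs sum_mono])
      fix e assume "e \<in> features s I"
      then show "\<bar>(W e c - W0 e c) * feature s z e\<bar> \<le> \<eta> * 1"
        unfolding abs_mult using W[OF _ c] abs_feature_le_one[of z s e] z \<eta>
        by (intro mult_mono) (auto intro: less_imp_le)
    qed
    also have "\<dots> \<le> d" using d by (simp add: \<eta>_def field_simps)
    finally show ?thesis .
  qed
  ultimately show ?thesis using gen unfolding I_def by blast
qed

lemma int_iterate_add_nat:
  assumes "bij T"
  shows "int_iterate T (k + int j) x = (T ^^ j) (int_iterate T k x)"
proof (induction j)
  case (Suc j)
  have step: "int_iterate T (k + 1) y = T (int_iterate T k y)" for k y
  proof (cases "k \<ge> 0")
    case True
    then have "nat (k + 1) = Suc (nat k)" by simp
    then show ?thesis using True by (simp add: int_iterate_def)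
  next
    case False
    then have "nat (- k) = Suc (nat (- (k + 1)))" by simp
    then have "T (int_iterate T k y) = (inv T ^^ nat (- (k + 1))) y"
      using False bij_is_surj[OF assms] by (simp add: int_iterate_def surj_f_inv_f)
    also have "\<dots> = int_iterate T (k + 1) y"
      using False by (cases "k = - 1") (auto simp: int_iterate_def)
    finally show ?thesis by simp
  qed
  have "k + int (Suc j) = (k + int j) + 1" by simp
  then show ?case using step[of "k + int j" x] Suc by (simp only: funpow.simps comp_apply)
qed simp

lemma iterate_continuous:
  fixes T :: "'a::topological_space \<Rightarrow> 'a"
  shows "continuous_on UNIV T \<Longrightarrow> continuous_on UNIV (T ^^ j)"
proof (induction j)
  case (Suc j)
  then have "continuous_on UNIV (T \<circ> (T ^^ j))"
    by (intro continuous_on_compose) (auto intro: continuous_on_subset)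
  then show ?case by simp
qed (simp add: id_def)

lemma separating_perturbation:
  fixes T :: "'a::metric_space \<Rightarrow> 'a" and f :: "'a \<Rightarrow> nat \<Rightarrow> real"
  assumes comp: "compact (UNIV :: 'a set)" and T: "homeomorphic_map euclidean euclidean T"
    and D: "D \<ge> 1"
    and dim: "\<And>\<U>. \<U> \<in> finite_open_covers \<Longrightarrow> \<exists>\<V>\<in>finite_open_covers. \<V> refines \<U> \<and>
       (\<forall>\<mu>\<in>invariant_measures T. (\<Sum>V\<in>\<V>. measure \<mu> V) < real D)"
    and f: "\<And>c. c < 42 * D \<Longrightarrow> continuous_on UNIV (\<lambda>x. f x c)" "\<And>x c. c < 42 * D \<Longrightarrow> f x c \<in> {0..1}"
    and \<epsilon>: "\<epsilon> > 0" and \<delta>: "\<delta> > 0"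
  shows "\<exists>g. (\<forall>c<42 * D. continuous_on UNIV (\<lambda>x. g x c) \<and> (\<forall>x. g x c \<in> {0..1} \<and> \<bar>g x c - f x c\<bar> \<le> \<delta>))
    \<and> (\<forall>x y. \<epsilon> \<le> dist x y \<longrightarrow> (\<exists>k. \<exists>c<42 * D. g (int_iterate T k x) c \<noteq> g (int_iterate T k y) c))"
proof -
  have bij: "bij T" and contT: "continuous_on UNIV T"
    using homeomorphic_imp_continuous_map[OF T] homeomorphic_imp_injective_map[OF T]
      homeomorphic_imp_surjective_map[OF T] by (auto simp: bij_def)
  \<comment> \<open>Sampling on the cover, shrinking the cube and perturbing the polynomial
    contribute an error \<open>d\<close> each. The bound \<open>1 / 2\<close> keeps
    \<open>1 - 2 * d\<close> nonnegative.\<close>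
  define d where "d = min (\<delta> / 3) (1 / 2)"
  have d: "d > 0" "d \<le> 1 / 2" "3 * d \<le> \<delta>" using \<delta> by (auto simp: d_def)
  obtain \<U> where \<U>: "\<U> \<in> finite_open_covers"
    and small': "\<forall>U\<in>\<U>. \<forall>x\<in>U. \<forall>y\<in>U. dist x y < \<epsilon> \<and> (\<forall>c<42 * D. \<bar>f x c - f y c\<bar> \<le> d)"
    using fine_cover_ex[where f = f and n = "42 * D", OF comp f(1) \<epsilon> d(1)] by (rule bexE) simp_all
  have small: "dist x y < \<epsilon> \<and> (\<forall>c<42 * D. \<bar>f x c - f y c\<bar> \<le> d)" if "U \<in> \<U>" "x \<in> U" "y \<in> U" for U x y
    using small' that by blast
  obtain \<V> where \<V>: "\<V> \<in> finite_open_covers" "\<V> refines \<U>"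
    and meas: "\<And>\<mu>. \<mu> \<in> invariant_measures T \<Longrightarrow> (\<Sum>V\<in>\<V>. measure \<mu> V) < real D"
    using dim[OF \<U>] by blast
  have fin: "finite \<V>" and op: "\<And>V. V \<in> \<V> \<Longrightarrow> open V" and cov: "\<Union>\<V> = UNIV"
    using \<V>(1) by (auto simp: finite_open_covers_def)
  have smallV: "dist x y < \<epsilon> \<and> (\<forall>c<42 * D. \<bar>f x c - f y c\<bar> \<le> d)" if "V \<in> \<V>" "x \<in> V" "y \<in> V" for V x y
    using \<V>(2) small that unfolding refines_def by (meson subsetD)
  obtain \<phi> F where \<phi>: "\<And>V. continuous_on UNIV (\<phi> V)" "\<And>V x. 0 \<le> \<phi> V x" "\<And>V x. V \<notin> \<V> \<Longrightarrow> \<phi> V x = (0::real)"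
    "\<And>x. (\<Sum>V\<in>\<V>. \<phi> V x) = 1"
    and F: "\<And>V. V \<in> \<V> \<Longrightarrow> closed (F V)" "\<And>V. V \<in> \<V> \<Longrightarrow> F V \<subseteq> V" "\<And>V x. V \<in> \<V> \<Longrightarrow> \<phi> V x \<noteq> 0 \<Longrightarrow> x \<in> F V"
    using closed_partition_of_unity[OF fin op cov] by metis
  have \<phi>1: "\<phi> V x \<le> 1" for V x
  proof (cases "V \<in> \<V>")
    case True
    then have "\<phi> V x \<le> (\<Sum>V\<in>\<V>. \<phi> V x)" using fin \<phi>(2) by (intro member_le_sum) auto
    then show ?thesis using \<phi>(4) by simp
  qed (simp add: \<phi>(3))
  have measF: "(\<Sum>V\<in>\<V>. measure \<mu> (F V)) < real D" if \<mu>: "\<mu> \<in> invariant_measures T" for \<mu>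
  proof -
    interpret prob_space \<mu> using \<mu> by (simp add: invariant_measures_def)
    have "sets \<mu> = sets borel" using \<mu> by (simp add: invariant_measures_def)
    then have "(\<Sum>V\<in>\<V>. measure \<mu> (F V)) \<le> (\<Sum>V\<in>\<V>. measure \<mu> V)"
      using F(2) op by (intro sum_mono finite_measure_mono) auto
    then show ?thesis using meas[OF \<mu>] by simp
  qed
  obtain N where N: "N \<ge> 1" "\<And>x. (\<Sum>k<N. card {V\<in>\<V>. (T ^^ k) x \<in> F V}) \<le> D * N"
    using uniform_orbit_average[where F = F, OF comp T fin F(1) measF] by blast
  define B where "B = N * N"
  have B1: "B \<ge> 1" using N by (simp add: B_def Suc_le_eq)
  \<comment> \<open>For empty \<open>V\<close> the point is arbitrary; \<open>\<phi> V\<close>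
    vanishes then.\<close>
  define pt where "pt V = (SOME x :: 'a. x \<in> V)" for V
  \<comment> \<open>Sample values moved into \<open>{d..1 - d}\<close>, so that an error of
    \<open>d\<close> cannot leave the cube.\<close>
  define a where "a V c = (1 - 2 * d) * f (pt V) c + d" for V c
  obtain G where G: "generic_map (21 * D) (2 * (B + 1)) ({..<4 * B} \<times> \<V>) G" "\<And>c. continuous_on UNIV (\<lambda>z. G z c)"
    "\<And>z c. c < 21 * D \<Longrightarrow> (\<forall>i. \<bar>z i\<bar> \<le> 1) \<Longrightarrow> \<bar>G z c - (\<Sum>v\<in>\<V>. a v c * z (0, v))\<bar> \<le> d"
    using generic_map_near_ex[of \<V> "4 * B" "2 * (B + 1)" d "21 * D" a] fin B1 d by auto
  obtain H where H: "generic_map (21 * D) (2 * (B + 1)) ({..<2 * B} \<times> \<V>) H" "\<And>c. continuous_on UNIV (\<lambda>z. H z c)"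
    "\<And>z c. c < 21 * D \<Longrightarrow> (\<forall>i. \<bar>z i\<bar> \<le> 1) \<Longrightarrow> \<bar>H z c - (\<Sum>v\<in>\<V>. a v (c + 21 * D) * z (0, v))\<bar> \<le> d"
    using generic_map_near_ex[of \<V> "2 * B" "2 * (B + 1)" d "21 * D" "\<lambda>v c. a v (c + 21 * D)"] fin B1 d by auto
  define z where "z L x = (\<lambda>(j, V). if j < L then \<phi> V ((T ^^ j) x) else 0)" for L :: nat and x
  have z1: "\<forall>i. \<bar>z L x i\<bar> \<le> 1" for L x using \<phi>(2) \<phi>1 by (auto simp: z_def)
  have zc: "continuous_on UNIV (z L)" for L
  proof (rule continuous_on_coordinatewise_then_product)
    fix i :: "nat \<times> 'a set"
    have "continuous_on UNIV (\<lambda>x. \<phi> (snd i) ((T ^^ fst i) x))"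
      by (rule continuous_on_compose2[OF \<phi>(1) iterate_continuous[OF contT]]) simp
    then show "continuous_on UNIV (\<lambda>x. z L x i)" by (cases "fst i < L") (simp_all add: z_def split_def)
  qed
  define g where "g x c = (if c < 21 * D then G (z (4 * B) x) c else H (z (2 * B) x) (c - 21 * D))" for x c
  have near: "\<bar>g x c - (\<Sum>V\<in>\<V>. a V c * \<phi> V x)\<bar> \<le> d" if "c < 42 * D" for x c
    using that B1 G(3)[of c "z (4 * B) x"] H(3)[of "c - 21 * D" "z (2 * B) x"] z1
    by (auto simp: g_def z_def)
  have conv: "(\<Sum>V\<in>\<V>. a V c * \<phi> V x) - u = (\<Sum>V\<in>\<V>. (a V c - u) * \<phi> V x)" for c x u
    by (simp add: left_diff_distrib sum_subtractf \<phi>(4) flip: sum_distrib_left)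
  have a01: "a V c \<in> {d..1 - d}" if "c < 42 * D" for V c
  proof -
    have "(1 - 2 * d) * f (pt V) c \<le> (1 - 2 * d) * 1" using f(2)[OF that, of "pt V"] d by (intro mult_left_mono) auto
    moreover have "0 \<le> (1 - 2 * d) * f (pt V) c" using f(2)[OF that, of "pt V"] d by (intro mult_nonneg_nonneg) auto
    ultimately show ?thesis by (simp add: a_def)
  qed
  have g01: "g x c \<in> {0..1}" if c: "c < 42 * D" for x c
  proof -
    have "(\<Sum>V\<in>\<V>. a V c * \<phi> V x) - d \<ge> 0"
      unfolding conv using a01[OF c] \<phi>(2) by (intro sum_nonneg mult_nonneg_nonneg) auto
    moreover have "(\<Sum>V\<in>\<V>. a V c * \<phi> V x) - (1 - d) \<le> 0"
      unfolding conv using a01[OF c] \<phi>(2) by (intro sum_nonpos mult_nonpos_nonneg) auto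
    ultimately show ?thesis using near[OF c, of x] by auto
  qed
  have gf: "\<bar>g x c - f x c\<bar> \<le> \<delta>" if c: "c < 42 * D" for x c
  proof -
    have "\<bar>(\<Sum>V\<in>\<V>. a V c * \<phi> V x) - f x c\<bar> \<le> (\<Sum>V\<in>\<V>. 2 * d * \<phi> V x)"
      unfolding conv
    proof (rule order_trans[OF sum_abs sum_mono])
      fix V assume V: "V \<in> \<V>"
      show "\<bar>(a V c - f x c) * \<phi> V x\<bar> \<le> 2 * d * \<phi> V x"
      proof (cases "\<phi> V x = 0")
        case False
        then have x: "x \<in> V" using F V by blast
        then have "pt V \<in> V" unfolding pt_def by (rule someI)
        then have 1: "\<bar>f (pt V) c - f x c\<bar> \<le> d" using smallV[OF V _ x] c by blast
        have "\<bar>1 - 2 * f (pt V) c\<bar> \<le> 1" using f(2)[OF c, of "pt V"] by auto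
        then have "\<bar>d * (1 - 2 * f (pt V) c)\<bar> \<le> d" using d by (simp add: abs_mult)
        moreover have "a V c - f x c = (f (pt V) c - f x c) + d * (1 - 2 * f (pt V) c)"
          by (simp add: a_def algebra_simps)
        ultimately have "\<bar>a V c - f x c\<bar> \<le> 2 * d" using 1 by linarith
        then show ?thesis using \<phi>(2)[of V x] by (simp add: abs_mult mult_right_mono)
      qed simp
    qed
    also have "\<dots> = 2 * d" by (simp add: \<phi>(4) flip: sum_distrib_left)
    finally show ?thesis using near[OF c, of x] d by linarith
  qed
  have gc: "continuous_on UNIV (\<lambda>x. g x c)" for c
  proof -
    have "continuous_on UNIV (\<lambda>x. G (z L x) c)" "continuous_on UNIV (\<lambda>x. H (z L x) c)" for L c
      using continuous_on_compose2[OF G(2) zc] continuous_on_compose2[OF H(2) zc] by auto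
    then show ?thesis unfolding g_def by (cases "c < 21 * D") simp_all
  qed
  have sep: "\<exists>k. \<exists>c<42 * D. g (int_iterate T k x) c \<noteq> g (int_iterate T k y) c" if xy: "\<epsilon> \<le> dist x y" for x y
  proof -
    \<comment> \<open>The word starts at time \<open>- B\<close>, so that position \<open>B\<close>,
      where the two words have to differ, belongs to the point itself.\<close>
    define w where "w x k V = \<phi> V (int_iterate T (int k - int B) x)" for x k V
    have it: "int_iterate T (int (k + j) - int B) x = (T ^^ j) (int_iterate T (int k - int B) x)" for k j x
      using int_iterate_add_nat[OF bij, of "int k - int B" j x] by (simp add: algebra_simps)
    have win: "win L (w x) k = z L (int_iterate T (int k - int B) x)" for L k x
      by (auto simp: win_def z_def w_def it[of k] fun_eq_iff simp del: of_nat_add)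
    have wt: "(\<Sum>i<N. weight (w x (k + i))) \<le> D * N" for x k
    proof -
      have "weight (w x (k + i)) \<le> card {V\<in>\<V>. (T ^^ i) (int_iterate T (int k - int B) x) \<in> F V}" for i
        unfolding weight_def w_def it using fin \<phi>(3) F(3) by (intro card_mono) auto
      then show ?thesis using N(2) by (meson order_trans sum_mono)
    qed
    have w0: "w x B V = \<phi> V x" for x V by (simp add: w_def int_iterate_def)
    have "\<exists>V\<in>\<V>. \<phi> V x \<noteq> 0" using \<phi>(4)[of x] by (metis sum.neutral zero_neq_one)
    then obtain V where V: "V \<in> \<V>" "\<phi> V x \<noteq> 0" by blast
    have "\<phi> V y = 0"
    proof (rule ccontr)
      assume "\<phi> V y \<noteq> 0"
      then have "dist x y < \<epsilon>" using smallV[of V x y] V F by blast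
      then show False using xy by simp
    qed
    then have ne: "w x B \<noteq> w y B" using V w0 by metis
    have "\<exists>k. \<exists>c<21 * D. G (win (4 * B) (w x) k) c \<noteq> G (win (4 * B) (w y) k) c
        \<or> H (win (2 * B) (w x) k) c \<noteq> H (win (2 * B) (w y) k) c"
      by (rule words_separated[OF fin _ _ N(1) D wt wt B_def ne G(1) H(1)]) (simp_all add: w_def \<phi>(3))
    then obtain k c where c: "c < 21 * D" and "G (win (4 * B) (w x) k) c \<noteq> G (win (4 * B) (w y) k) c
        \<or> H (win (2 * B) (w x) k) c \<noteq> H (win (2 * B) (w y) k) c" by blast
    then have "g (int_iterate T (int k - int B) x) c \<noteq> g (int_iterate T (int k - int B) y) c
      \<or> g (int_iterate T (int k - int B) x) (c + 21 * D) \<noteq> g (int_iterate T (int k - int B) y) (c + 21 * D)"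
      by (simp add: g_def win)
    moreover have "c < 42 * D" "c + 21 * D < 42 * D" using c by auto
    ultimately show ?thesis by blast
  qed
  show ?thesis using gc g01 gf sep by (intro exI[of _ g]) blast
qed

section \<open>The function space\<close>

lemma cube_maps_iff:
  assumes comp: "compact (UNIV :: 'a::topological_space set)" and n: "n \<ge> 1"
  shows "(f :: 'a \<Rightarrow> nat \<Rightarrow> real) \<in> mspace (cube_maps n) \<longleftrightarrow>
    (\<forall>x. f x \<in> {..<n} \<rightarrow>\<^sub>E {0..1}) \<and> (\<forall>c<n. continuous_on UNIV (\<lambda>x. f x c))"
  unfolding mspace_cube_maps[OF comp] mtopology_cube[OF n]
  by (auto simp: continuous_map_componentwise continuous_map_in_subtopology PiE_iff image_subset_iff Pi_iff)

lemma mdist_cube_ge: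
  assumes "n \<ge> 1" "c < n"
  shows "\<bar>u c - v c\<bar> \<le> mdist (cube n) u v"
  unfolding mdist_cube[OF assms(1)] using assms by (intro Max_ge) auto

lemma mdist_cube_maps_ge:
  assumes comp: "compact (UNIV :: 'a::topological_space set)" and n: "n \<ge> 1"
    and f: "f \<in> mspace (cube_maps n)" and g: "(g :: 'a \<Rightarrow> nat \<Rightarrow> real) \<in> mspace (cube_maps n)" and c: "c < n"
  shows "\<bar>f x c - g x c\<bar> \<le> mdist (cube_maps n) f g"
proof -
  have ne: "{..<n} \<noteq> {}" using n by (auto simp: lessThan_empty_iff)
  have "mdist (cube n) (f y) (g y) \<le> 1" for y
    unfolding mdist_cube[OF n]
  proof (rule Max.boundedI)
    fix a assume "a \<in> (\<lambda>c. \<bar>f y c - g y c\<bar>) ` {..<n}"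
    then obtain c where c: "c < n" "a = \<bar>f y c - g y c\<bar>" by auto
    have "f y c \<in> {0..1}" "g y c \<in> {0..1}"
      using f g c(1) unfolding cube_maps_iff[OF comp n] by (auto simp: PiE_iff)
    then show "a \<le> 1" using c by auto
  qed (use ne in auto)
  then have "bdd_above (range (\<lambda>y. mdist (cube n) (f y) (g y)))" by (intro bdd_aboveI[of _ 1]) auto
  then have "mdist (cube n) (f x) (g x) \<le> mdist (cube_maps n) f g"
    unfolding mdist_cube_maps[OF f g] by (rule cSUP_upper[rotated]) simp
  then show ?thesis using mdist_cube_ge[OF n c] order_trans by blast
qed

lemma mdist_cube_maps_le:
  assumes n: "n \<ge> 1" and f: "f \<in> mspace (cube_maps n)" and g: "g \<in> mspace (cube_maps n)"
    and le: "\<And>x c. c < n \<Longrightarrow> \<bar>f x c - g x c\<bar> \<le> r"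
  shows "mdist (cube_maps n) f g \<le> r"
proof -
  have ne: "{..<n} \<noteq> {}" using n by (auto simp: lessThan_empty_iff)
  show ?thesis
    unfolding mdist_cube_maps[OF f g] mdist_cube[OF n]
    using le ne by (intro cSUP_least Max.boundedI) auto
qed

lemma mcomplete_cube_maps:
  assumes n: "n \<ge> 1"
  shows "Metric_space.mcomplete (mspace (cube_maps n)) (mdist (cube_maps n :: ('a::topological_space \<Rightarrow> nat \<Rightarrow> real) metric))"
proof -
  interpret Metric_space "mspace (cube n)" "mdist (cube n)" by simp
  have "compact_space (mtopology_of (cube n))"
    unfolding mtopology_cube[OF n] by (intro compact_space_product_topology[THEN iffD2] disjI2 ballI) (simp add: compact_space_subtopology)
  then have "mcomplete" by (intro compact_space_imp_mcomplete) (simp add: mtopology_of_def)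
  then show ?thesis using mcomplete_cfunspace[of euclidean]
    by (simp add: mcomplete_of_def Self_def del: mspace_cfunspace)
qed

lemma continuous_int_iterate:
  fixes T :: "'a::topological_space \<Rightarrow> 'a"
  assumes T: "homeomorphic_map euclidean euclidean T"
  shows "continuous_on UNIV (int_iterate T k)"
proof -
  have cont: "continuous_on UNIV T" and bij: "bij T"
    using homeomorphic_imp_continuous_map[OF T] homeomorphic_imp_injective_map[OF T]
      homeomorphic_imp_surjective_map[OF T] by (auto simp: bij_def)
  have "continuous_on UNIV (inv T)"
    unfolding continuous_on_open_vimage[OF open_UNIV]
    using homeomorphic_imp_open_map[OF T] bij by (auto simp: open_map_def bij_vimage_eq_inv_image inv_inv_eq bij_imp_bij_inv)
  then show ?thesis
    using iterate_continuous cont unfolding int_iterate_def by auto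
qed

text \<open>A continuous injection of a compact space into a Hausdorff space is an
  embedding.\<close>

lemma embedding_cube_maps_eq:
  fixes T :: "'a::metric_space \<Rightarrow> 'a"
  assumes comp: "compact (UNIV :: 'a set)" and T: "homeomorphic_map euclidean euclidean T" and n: "n \<ge> 1"
  shows "embedding_cube_maps T n = {f \<in> mspace (cube_maps n). inj (orbit_map T f)}"
proof -
  have "embedding_map euclidean (product_topology (\<lambda>_. mtopology_of (cube n)) UNIV) (orbit_map T f)
      \<longleftrightarrow> inj (orbit_map T f)" if f: "f \<in> mspace (cube_maps n)" for f
  proof
    assume "embedding_map euclidean (product_topology (\<lambda>_. mtopology_of (cube n)) UNIV) (orbit_map T f)"
    then show "inj (orbit_map T f)"
      unfolding embedding_map_def using homeomorphic_imp_injective_map by fastforce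
  next
    assume "inj (orbit_map T f)"
    moreover have "continuous_map euclidean (product_topology (\<lambda>_. mtopology_of (cube n)) UNIV) (orbit_map T f)"
      unfolding continuous_map_componentwise_UNIV
    proof
      fix k
      have "continuous_map euclidean (mtopology_of (cube n)) f"
        using f unfolding mspace_cube_maps[OF comp] by simp
      moreover have "continuous_map euclidean euclidean (int_iterate T k)"
        using continuous_int_iterate[OF T] by simp
      ultimately have "continuous_map euclidean (mtopology_of (cube n)) (f \<circ> int_iterate T k)"
        by (rule continuous_map_compose[rotated])
      then show "continuous_map euclidean (mtopology_of (cube n)) (\<lambda>x. orbit_map T f x k)"
        by (simp add: orbit_map_def comp_def)
    qed
    moreover have "Hausdorff_space (product_topology (\<lambda>_::int. mtopology_of (cube n)) UNIV)"
      by (simp add: Hausdorff_space_product_topology mtopology_of_def Metric_space.Hausdorff_space_mtopology)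
    moreover have "compact_space (euclidean :: 'a topology)"
      using comp by (simp add: compact_space_def)
    ultimately show "embedding_map euclidean (product_topology (\<lambda>_. mtopology_of (cube n)) UNIV) (orbit_map T f)"
      by (intro continuous_imp_embedding_map) auto
  qed
  then show ?thesis unfolding embedding_cube_maps_def by blast
qed

text \<open>Pairs at distance at least \<open>e\<close> form a compact set, which makes separation
  an open condition; injectivity is the intersection of countably many such conditions.\<close>

definition separating_maps :: "('a::metric_space \<Rightarrow> 'a) \<Rightarrow> nat \<Rightarrow> real \<Rightarrow> ('a \<Rightarrow> nat \<Rightarrow> real) set" where
  "separating_maps T n e = {f \<in> mspace (cube_maps n). \<forall>x y. e \<le> dist x y \<longrightarrow> orbit_map T f x \<noteq> orbit_map T f y}"

text \<open>Otherwise there are maps converging uniformly to \<open>f\<close> that fail to separate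
  pairs at distance at least \<open>e\<close>; then \<open>f\<close> fails to separate a limit of
  these pairs.\<close>

lemma openin_separating_maps:
  fixes T :: "'a::metric_space \<Rightarrow> 'a"
  assumes comp: "compact (UNIV :: 'a set)" and T: "homeomorphic_map euclidean euclidean T" and n: "n \<ge> 1"
  shows "openin (mtopology_of (cube_maps n)) (separating_maps T n e)"
proof -
  interpret Metric_space "mspace (cube_maps n :: ('a \<Rightarrow> _) metric)" "mdist (cube_maps n)"
    by (rule Metric_space_mspace_mdist)
  have "\<exists>r>0. mball f r \<subseteq> separating_maps T n e" if f: "f \<in> separating_maps T n e" for f
  proof (rule ccontr)
    assume no: "\<not> ?thesis"
    have fM: "f \<in> mspace (cube_maps n)" using f by (simp add: separating_maps_def)
    have "\<exists>g p. g \<in> mspace (cube_maps n) \<and> mdist (cube_maps n) f g < 1 / Suc j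
        \<and> e \<le> dist (fst p) (snd p) \<and> orbit_map T g (fst p) = orbit_map T g (snd p)" for j
    proof -
      have "\<not> mball f (1 / Suc j) \<subseteq> separating_maps T n e" using no by simp
      then obtain g where "g \<in> mball f (1 / Suc j)" "g \<notin> separating_maps T n e" by blast
      then show ?thesis
        by (intro exI[of _ g]) (auto simp: separating_maps_def simp del: mspace_cfunspace)
    qed
    then obtain g p where g: "\<And>j. g j \<in> mspace (cube_maps n)" "\<And>j. mdist (cube_maps n) f (g j) < 1 / Suc j"
      and p: "\<And>j. e \<le> dist (fst (p j)) (snd (p j))" "\<And>j. orbit_map T (g j) (fst (p j)) = orbit_map T (g j) (snd (p j))"
      by metis
    have "compact (UNIV :: ('a \<times> 'a) set)" using compact_Times[OF comp comp] by simp
    then obtain l r where r: "strict_mono r" and lim: "(p \<circ> r) \<longlonglongrightarrow> l"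
      unfolding compact_eq_seq_compact_metric seq_compact_def by (metis UNIV_I)
    have lim12: "(\<lambda>j. fst (p (r j))) \<longlonglongrightarrow> fst l" "(\<lambda>j. snd (p (r j))) \<longlonglongrightarrow> snd l"
      using tendsto_fst[OF lim] tendsto_snd[OF lim] by (simp_all add: comp_def)
    have "e \<le> dist (fst l) (snd l)"
      by (rule LIMSEQ_le_const[OF tendsto_dist[OF lim12]]) (use p(1) in auto)
    moreover have "orbit_map T f (fst l) = orbit_map T f (snd l)"
      unfolding orbit_map_def
    proof (rule ext)
      fix k
      define h where "h x = f (int_iterate T k x)" for x
      have "h (fst l) c = h (snd l) c" if c: "c < n" for c
      proof -
        have "continuous_on UNIV (\<lambda>x. f x c)" using fM c unfolding cube_maps_iff[OF comp n] by simp
        then have hc: "continuous_on UNIV (\<lambda>x. h x c)"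
          unfolding h_def by (rule continuous_on_compose2[OF _ continuous_int_iterate[OF T]]) simp
        have "(\<lambda>j. h (fst (p (r j))) c - h (snd (p (r j))) c) \<longlonglongrightarrow> h (fst l) c - h (snd l) c"
          by (intro tendsto_diff continuous_on_tendsto_compose[OF hc] lim12) auto
        moreover have "(\<lambda>j. h (fst (p (r j))) c - h (snd (p (r j))) c) \<longlonglongrightarrow> 0"
        proof (rule Lim_null_comparison)
          show "\<forall>\<^sub>F j in sequentially. norm (h (fst (p (r j))) c - h (snd (p (r j))) c) \<le> 2 * (1 / Suc j)"
          proof (rule always_eventually, rule allI)
            fix j
            have "g (r j) (int_iterate T k (fst (p (r j)))) = g (r j) (int_iterate T k (snd (p (r j))))"
              using p(2)[of "r j"] unfolding orbit_map_def by metis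
            moreover have "\<bar>f x c - g (r j) x c\<bar> \<le> 1 / Suc j" for x
            proof -
              have "\<bar>f x c - g (r j) x c\<bar> \<le> 1 / Suc (r j)"
                using mdist_cube_maps_ge[OF comp n fM g(1) c, of x "r j"] g(2)[of "r j"] by linarith
              also have "\<dots> \<le> 1 / Suc j" using seq_suble[OF r, of j] by (intro divide_left_mono) auto
              finally show ?thesis .
            qed
            note this[of "int_iterate T k (fst (p (r j)))"] this[of "int_iterate T k (snd (p (r j)))"]
            ultimately show "norm (h (fst (p (r j))) c - h (snd (p (r j))) c) \<le> 2 * (1 / Suc j)"
              unfolding h_def by (simp add: abs_le_iff)
          qed
          show "(\<lambda>j. 2 * (1 / real (Suc j))) \<longlonglongrightarrow> 0"
            using tendsto_mult_right_zero[OF LIMSEQ_inverse_real_of_nat, of 2] by (simp add: inverse_eq_divide)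
        qed
        ultimately show ?thesis using LIMSEQ_unique by fastforce
      qed
      moreover have "h x \<in> {..<n} \<rightarrow>\<^sub>E {0..1}" for x
        using fM unfolding cube_maps_iff[OF comp n] h_def by simp
      ultimately show "f (int_iterate T k (fst l)) = f (int_iterate T k (snd l))"
        unfolding h_def[symmetric] by (intro PiE_ext[of _ "{..<n}" "\<lambda>_. {0..1}"]) auto
    qed
    ultimately show False using f unfolding separating_maps_def by blast
  qed
  moreover have "separating_maps T n e \<subseteq> mspace (cube_maps n)" by (auto simp: separating_maps_def)
  ultimately show ?thesis unfolding mtopology_of_def openin_mtopology by blast
qed

section \<open>The dynamical dimension as a bound on the total mass of a cover\<close>

lemma integral_cover_ord:
  assumes "prob_space \<mu>" "finite \<V>" "\<And>V. V \<in> \<V> \<Longrightarrow> V \<in> sets \<mu>"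
  shows "(\<integral>x. cover_ord \<V> x \<partial>\<mu>) = (\<Sum>V\<in>\<V>. measure \<mu> V) - 1"
proof -
  interpret prob_space \<mu> by fact
  have "cover_ord \<V> x = (\<Sum>V\<in>\<V>. indicator V x) - 1" for x
    using assms(2) by (simp add: cover_ord_def indicator_def sum.If_cases Int_def)
  then have "(\<integral>x. cover_ord \<V> x \<partial>\<mu>) = (\<integral>x. (\<Sum>V\<in>\<V>. indicator V x) - 1 \<partial>\<mu>)" by simp
  also have "\<dots> = (\<Sum>V\<in>\<V>. measure \<mu> V) - 1"
    using assms by (subst Bochner_Integration.integral_diff)
      (auto simp: Bochner_Integration.integral_sum prob_space emeasure_eq_measure)
  finally show ?thesis .
qed

text \<open>The order of a cover is one less than the sum of the indicators of its members, hence
  \<open>D - 1\<close> on one side and \<open>D\<close> on the other.\<close>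

lemma dyn_dim_bound:
  fixes T :: "'a::metric_space \<Rightarrow> 'a"
  assumes "dyn_dim T < ereal (real D - 1)" and \<U>: "\<U> \<in> finite_open_covers"
  shows "\<exists>\<V>\<in>finite_open_covers. \<V> refines \<U> \<and> (\<forall>\<mu>\<in>invariant_measures T. (\<Sum>V\<in>\<V>. measure \<mu> V) < real D)"
proof -
  have "cover_dyn_dim \<U> T < ereal (real D - 1)"
    using assms SUP_upper[OF \<U>, of "\<lambda>\<U>. cover_dyn_dim \<U> T"] by (auto simp: dyn_dim_def intro: le_less_trans)
  then obtain \<V> where \<V>: "\<V> \<in> finite_open_covers" "\<V> refines \<U>" and lt: "cover_ord_dyn \<V> T < ereal (real D - 1)"
    unfolding cover_dyn_dim_def INF_less_iff by blast
  have "(\<Sum>V\<in>\<V>. measure \<mu> V) < real D" if \<mu>: "\<mu> \<in> invariant_measures T" for \<mu>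
  proof -
    have "ereal (\<integral>x. cover_ord \<V> x \<partial>\<mu>) \<le> cover_ord_dyn \<V> T"
      unfolding cover_ord_dyn_def by (rule SUP_upper[OF \<mu>])
    then have "ereal (\<integral>x. cover_ord \<V> x \<partial>\<mu>) < ereal (real D - 1)" using lt by (rule le_less_trans)
    moreover have "(\<integral>x. cover_ord \<V> x \<partial>\<mu>) = (\<Sum>V\<in>\<V>. measure \<mu> V) - 1"
      using \<mu> \<V>(1) by (intro integral_cover_ord) (auto simp: invariant_measures_def finite_open_covers_def)
    ultimately show ?thesis by simp
  qed
  then show ?thesis using \<V> by blast
qed

lemma dense_separating_maps:
  fixes T :: "'a::metric_space \<Rightarrow> 'a"
  assumes comp: "compact (UNIV :: 'a set)" and T: "homeomorphic_map euclidean euclidean T"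
    and D: "D \<ge> 1" "dyn_dim T < ereal (real D - 1)" and e: "e > 0"
  shows "mtopology_of (cube_maps (42 * D)) closure_of separating_maps T (42 * D) e = mspace (cube_maps (42 * D))"
proof -
  define n where "n = 42 * D"
  have n: "n \<ge> 1" using D by (simp add: n_def)
  interpret Metric_space "mspace (cube_maps n :: ('a \<Rightarrow> _) metric)" "mdist (cube_maps n)"
    by (rule Metric_space_mspace_mdist)
  have "\<exists>g\<in>separating_maps T n e. g \<in> mball f r" if f: "f \<in> mspace (cube_maps n)" and r: "r > 0" for f r
  proof -
    have f1: "continuous_on UNIV (\<lambda>x. f x c)" if "c < 42 * D" for c
      using f that unfolding cube_maps_iff[OF comp n] by (auto simp: n_def)
    have f2: "f x c \<in> {0..1}" if "c < 42 * D" for x c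
      using f that unfolding cube_maps_iff[OF comp n] by (auto simp: n_def PiE_iff)
    have "r / 2 > 0" using r by simp
    obtain g0 where g0: "\<forall>c<42 * D. continuous_on UNIV (\<lambda>x. g0 x c) \<and> (\<forall>x. g0 x c \<in> {0..1} \<and> \<bar>g0 x c - f x c\<bar> \<le> r / 2)"
      and sep: "\<forall>x y. e \<le> dist x y \<longrightarrow> (\<exists>k. \<exists>c<42 * D. g0 (int_iterate T k x) c \<noteq> g0 (int_iterate T k y) c)"
      using separating_perturbation[where f = f, OF comp T D(1) dyn_dim_bound[OF D(2)] f1 f2 e \<open>r / 2 > 0\<close>]
      by blast
    \<comment> \<open>The perturbation is controlled below \<open>n\<close> only, and points of the
      cube are extensional.\<close>
    define g where "g x = restrict (g0 x) {..<n}" for x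
    have gM: "g \<in> mspace (cube_maps n)"
      unfolding cube_maps_iff[OF comp n] using g0 by (auto simp: g_def n_def)
    have "mdist (cube_maps n) f g \<le> r / 2"
      using g0 by (intro mdist_cube_maps_le[OF n f gM]) (auto simp: g_def n_def abs_minus_commute)
    then have "g \<in> mball f r" using f gM r by (simp del: mspace_cfunspace)
    moreover have "orbit_map T g x \<noteq> orbit_map T g y" if le: "e \<le> dist x y" for x y
    proof
      assume eq: "orbit_map T g x = orbit_map T g y"
      obtain k c where c: "c < 42 * D" and ne: "g0 (int_iterate T k x) c \<noteq> g0 (int_iterate T k y) c"
        using sep le by blast
      have "g (int_iterate T k x) c = g (int_iterate T k y) c"
        using eq unfolding orbit_map_def by metis
      then show False using c ne by (simp add: g_def n_def)
    qed
    ultimately show ?thesis using gM by (intro bexI[of _ g]) (auto simp: separating_maps_def)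
  qed
  then show ?thesis unfolding n_def[symmetric] mtopology_of_def metric_closure_of by blast
qed

theorem theorem1p3:
  fixes T :: "'a::metric_space \<Rightarrow> 'a"
  assumes "compact (UNIV :: 'a set)"
    and "homeomorphic_map euclidean euclidean T"
    and "dyn_dim T < \<infinity>"
  shows "\<exists>n\<ge>1. gdelta_in (mtopology_of (cube_maps n)) (embedding_cube_maps T n)
             \<and> mtopology_of (cube_maps n) closure_of embedding_cube_maps T n
                 = topspace (mtopology_of (cube_maps n))"
proof -
  note comp = assms(1) and T = assms(2)
  obtain D0 :: nat where "dyn_dim T < ereal (real D0)" using assms(3) less_PInf_Ex_of_nat by auto
  then have D: "D0 + 1 \<ge> 1" "dyn_dim T < ereal (real (D0 + 1) - 1)" by simp_all
  \<comment> \<open>The number \<open>D0 + 1\<close> plays the part of \<open>D\<close>, and the two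
    polynomial maps take \<open>21 * D\<close> coordinates each.\<close>
  define n where "n = 42 * (D0 + 1)"
  have n: "n \<ge> 1" by (simp add: n_def)
  let ?U = "\<lambda>m::nat. separating_maps T n (1 / Suc m)"
  interpret Metric_space "mspace (cube_maps n :: ('a \<Rightarrow> _) metric)" "mdist (cube_maps n)"
    by (rule Metric_space_mspace_mdist)
  have eq: "embedding_cube_maps T n = \<Inter>(range ?U)"
  proof (rule set_eqI, rule iffI)
    fix f assume "f \<in> embedding_cube_maps T n"
    then show "f \<in> \<Inter>(range ?U)"
      unfolding embedding_cube_maps_eq[OF comp T n] by (auto simp: separating_maps_def inj_eq)
  next
    fix f assume f: "f \<in> \<Inter>(range ?U)"
    have "inj (orbit_map T f)"
    proof (rule injI, rule ccontr)
      fix x y assume xy: "orbit_map T f x = orbit_map T f y" "x \<noteq> y"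
      obtain m where "1 / Suc m < dist x y"
        using reals_Archimedean[of "dist x y"] xy(2) by (auto simp: inverse_eq_divide)
      then show False using f xy by (auto simp: separating_maps_def dest!: spec[of _ m] less_imp_le)
    qed
    then show "f \<in> embedding_cube_maps T n"
      unfolding embedding_cube_maps_eq[OF comp T n] using f by (auto simp: separating_maps_def)
  qed
  have op: "openin (mtopology_of (cube_maps n)) (?U m)" for m
    by (rule openin_separating_maps[OF comp T n])
  have dense: "mtopology_of (cube_maps n) closure_of ?U m = mspace (cube_maps n)" for m
    unfolding n_def by (rule dense_separating_maps[OF comp T D]) simp
  have "gdelta_in (mtopology_of (cube_maps n)) (embedding_cube_maps T n)"
    unfolding eq using op by (intro gdelta_in_Inter) (auto intro: open_imp_gdelta_in)
  moreover have "mtopology closure_of \<Inter>(range ?U) = mspace (cube_maps n)"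
    using op dense by (intro metric_Baire_category mcomplete_cube_maps[OF n]) (auto simp: mtopology_of_def)
  then have "mtopology_of (cube_maps n) closure_of embedding_cube_maps T n = topspace (mtopology_of (cube_maps n))"
    unfolding eq topspace_mtopology_of by (simp only: mtopology_of_def)
  ultimately show ?thesis using n by blast
qed

end
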